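(* Let $\Phi$ be a $\mathcal{C}^1$ convex growth function that satisfies the $\nabla_2$-condition, and let $f$ be holomorphic on $\mathbb{C}_+$. Then $f\in H^\Phi(\mathbb{C}_+)$ if and only if $f^*\in L^\Phi(\mathbb{R})$. Moreover, $\|f\|_{H^\Phi}^{lux}\approx \|f^*\|_{L^\Phi}^{lux}$ with constants independent of $f$.
   Context: $\mathbb{C}_+=\{x+iy: y>0\}$. A growth function is a continuous nondecreasing function from $[0,\infty)$ onto $[0,\infty)$. A convex growth function satisfies the $\nabla_2$-condition if both $\Phi$ and its complementary function $\Psi(s)=\sup_{t\ge0}\{ts-\Phi(t)\}$ satisfy $F(2t)\le KF(t)$ for some $K>1$, all $t\ge0$. $\|g\|_{L^\Phi}^{lux}=\inf\{\lambda>0:\int_{\mathbb{R}}\Phi(|g|/\lambda)dx\le1\}$, $L^\Phi(\mathbb{R})$ the functions with finite such norm; $H^\Phi(\mathbb{C}_+)$ is the space of holomorphic $f$ with $\|f\|^{lux}_{H^\Phi}:=\sup_{y>0}\|f(\cdot+iy)\|^{lux}_{L^\Phi}<\infty$. The nontangential maximal function is $f^*(x)=\sup_{z\in\Gamma(x)}|f(z)|$ with $\Gamma(x)=\{t+iy\in\mathbb{C}_+:|t-x|<y\}$. *)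

theory Defs
  imports "HOL-Analysis.Analysis"
begin

definition growth_function :: "(real \<Rightarrow> real) \<Rightarrow> bool" where
  "growth_function \<Phi> \<longleftrightarrow> continuous_on {0..} \<Phi> \<and> mono_on {0..} \<Phi> \<and> \<Phi> ` {0..} = {0..}"

definition C1_on_nonneg :: "(real \<Rightarrow> real) \<Rightarrow> bool" where
  "C1_on_nonneg \<Phi> \<longleftrightarrow> (\<exists>\<Phi>'. continuous_on {0..} \<Phi>' \<and>
      (\<forall>t\<ge>0. (\<Phi> has_real_derivative \<Phi>' t) (at t within {0..})))"

text \<open>Complementary function, extended-real valued (the sup may a priori be infinite).\<close>
definition complementary :: "(real \<Rightarrow> real) \<Rightarrow> real \<Rightarrow> ereal" where
  "complementary \<Phi> s = (SUP t\<in>{0..}. ereal (t * s - \<Phi> t))"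

definition doubling :: "(real \<Rightarrow> ereal) \<Rightarrow> bool" where
  "doubling F \<longleftrightarrow> (\<exists>K>1. \<forall>t\<ge>0. F (2 * t) \<le> ereal K * F t)"

definition nabla2 :: "(real \<Rightarrow> real) \<Rightarrow> bool" where
  "nabla2 \<Phi> \<longleftrightarrow> doubling (\<lambda>t. ereal (\<Phi> t)) \<and>
     (\<forall>s\<ge>0. complementary \<Phi> s < \<infinity>) \<and> doubling (complementary \<Phi>)"

definition Phi_ext :: "(real \<Rightarrow> real) \<Rightarrow> ennreal \<Rightarrow> ennreal" where
  "Phi_ext \<Phi> t = (if t = top then top else ennreal (\<Phi> (enn2real t)))"

text \<open>Luxemburg norm of a nonnegative (possibly infinite-valued) function on R;
  equals +inf iff the function is not in L^Phi.\<close>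
definition lux_norm :: "(real \<Rightarrow> real) \<Rightarrow> (real \<Rightarrow> ennreal) \<Rightarrow> ereal" where
  "lux_norm \<Phi> g = Inf {ereal r | r. r > 0 \<and>
      (\<integral>\<^sup>+ x. Phi_ext \<Phi> (g x / ennreal r) \<partial>lborel) \<le> 1}"

definition upper_half_plane :: "complex set" where
  "upper_half_plane = {z. Im z > 0}"

definition hardy_orlicz_norm :: "(real \<Rightarrow> real) \<Rightarrow> (complex \<Rightarrow> complex) \<Rightarrow> ereal" where
  "hardy_orlicz_norm \<Phi> f = (SUP y\<in>{0<..}. lux_norm \<Phi> (\<lambda>x. ennreal (cmod (f (Complex x y)))))"

definition cone :: "real \<Rightarrow> complex set" where
  "cone x = {z. \<bar>Re z - x\<bar> < Im z}"

definition nontangential_max :: "(complex \<Rightarrow> complex) \<Rightarrow> real \<Rightarrow> ennreal" where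
  "nontangential_max f x = (SUP z\<in>cone x. ennreal (cmod (f z)))"

end

theory Submission
  imports Defs "HOL-Complex_Analysis.Complex_Analysis"
begin

text \<open>
  The nontangential maximal function dominates every horizontal slice of |f|, so only the bound
  of f* by the Hardy norm needs work. On each line Im z = e > 0 the function |f| has a Poisson
  majorant, which is controlled by averages over balls centred at the vertex of the cone; a Vitali
  covering then gives a weak type inequality for the level sets of the maximal function in terms of
  the part of |f| above a proportional height. Doubling of the complementary function forces
  \<Phi>(a t) \<ge> 2 a \<Phi>(t) for some a > 1, so that \<Phi>(t) / t at least doubles from one level
  a^k to the next. Summing the weak type inequalities over the levels a^k is then dominated by the
  top level, which yields the strong bound, uniformly in e. Let e tend to 0.
\<close>

section \<open>Poisson majorant in the half plane\<close>

text \<open>The majorant comes from Cauchy's formula alone: on the real line the kernel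
  \<open>1 / ((w - z) * (w - cnj z))\<close> has modulus \<open>1 / |w - z|^2\<close>, which is the
  Poisson kernel up to a constant depending on Im z, and its second pole lies outside the half
  plane. On each line only the integral of \<Phi>(|f|) is under control. Since \<Phi> grows at least
  linearly, the mass of |f| on [-s, s] then grows at most linearly in s, and the quadratic decay of
  the kernel absorbs this. The shift by e makes the function holomorphic across the real axis, so
  boundary values never have to be constructed.

  The weak type inequality must keep only the part of |f| above a fraction of the level. With all of
  |f| on the right the weights \<Phi>(a^k) / a^k, which increase with k, would have a divergent sum;
  the truncation leaves at a point t only the levels below |f(t)|.

  The final constant is 1280 a: 128 is the ratio of level to truncation height, a the ratio of
  neighbouring levels, and 10 the bound of the layer sum, removed by convexity.\<close>

lemma norm_contour_integral_segment_le:
  fixes k :: "complex \<Rightarrow> complex" and P d :: complex and a b :: real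
  assumes ab: "a < b" and d: "norm d = 1"
    and pq: "p = P + of_real a * d" "q = P + of_real b * d"
    and cont: "continuous_on (closed_segment p q) k"
  shows "ennreal (norm (contour_integral (linepath p q) k))
      \<le> (\<integral>\<^sup>+t. ennreal (norm (k (P + of_real t * d))) * indicator {a..b} t \<partial>lborel)"
proof -
  have line: "linepath p q s = P + of_real (a + (b - a) * s) * d" for s
    by (simp add: linepath_def pq algebra_simps scaleR_conv_of_real)
  have qp: "q - p = of_real (b - a) * d" by (simp add: pq algebra_simps)
  have nqp: "norm (q - p) = b - a" using ab d by (simp only: qp norm_mult norm_of_real) simp
  have seg: "closed_segment p q = (\<lambda>t. P + of_real t * d) ` {a..b}"
  proof -
    have "closed_segment p q = linepath p q ` {0..1}"
      by (metis path_image_def path_image_linepath)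
    also have "\<dots> = (\<lambda>t. P + of_real t * d) ` ((\<lambda>s. a + (b - a) * s) ` {0..1})"
      unfolding image_image by (rule image_cong) (simp_all only: line)
    also have "(\<lambda>s. a + (b - a) * s) ` {0..1} = {a..b}"
    proof -
      have "(\<lambda>s. a + (b - a) * s) = (\<lambda>s. (b - a) * s + a)" by (simp add: add.commute)
      then show ?thesis using ab by (simp only: image_affinity_atLeastAtMost) simp
    qed
    finally show ?thesis .
  qed
  have contk: "continuous_on {a..b} (\<lambda>t. k (P + of_real t * d))"
    by (rule continuous_on_compose2[OF cont]) (auto intro!: continuous_intros simp: seg)
  \<comment> \<open>The indicator is part of \<open>F\<close> because \<open>k\<close> is continuous
    on the segment only; the cut-off function is measurable on the whole line.\<close>
  define F where "F t = ennreal (norm (k (P + of_real t * d))) * indicator {a..b} t" for t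
  have F_meas: "F \<in> borel_measurable borel"
  proof -
    have "(\<lambda>t. indicator {a..b} t *\<^sub>R norm (k (P + of_real t * d))) \<in> borel_measurable borel"
      by (intro borel_measurable_continuous_on_indicator continuous_intros contk) auto
    then have "(\<lambda>t. ennreal (indicator {a..b} t *\<^sub>R norm (k (P + of_real t * d)))) \<in> borel_measurable borel"
      by measurable
    also have "(\<lambda>t. ennreal (indicator {a..b} t *\<^sub>R norm (k (P + of_real t * d)))) = F"
      by (auto simp: F_def indicator_def)
    finally show ?thesis .
  qed
  define \<phi> where "\<phi> s = k (linepath p q s) * (q - p)" for s
  have cont\<phi>: "continuous_on {0..1} \<phi>"
    unfolding \<phi>_def
    by (intro continuous_intros continuous_on_compose2[OF cont])
       (auto simp: linepath_in_path)
  have int\<phi>: "set_integrable lborel {0..1} \<phi>"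
    by (rule borel_integrable_atLeastAtMost'[OF cont\<phi>])
  have "contour_integral (linepath p q) k = (LINT s:{0..1}|lborel. \<phi> s)"
    unfolding set_borel_integral_eq_integral(2)[OF int\<phi>]
    by (simp add: contour_integral_integral \<phi>_def[abs_def])
  then have "ennreal (norm (contour_integral (linepath p q) k))
      \<le> (\<integral>\<^sup>+s. ennreal (norm (indicator {0..1} s *\<^sub>R \<phi> s)) \<partial>lborel)"
    using integral_norm_bound_ennreal[OF int\<phi>[unfolded set_integrable_def]]
    by (simp add: set_lebesgue_integral_def)
  also have "\<dots> = (\<integral>\<^sup>+s. ennreal \<bar>b - a\<bar> * F (a + (b - a) * s) \<partial>lborel)"
  proof (rule nn_integral_cong)
    fix s :: real
    have 1: "a + (b - a) * s \<in> {a..b} \<longleftrightarrow> s \<in> {0..1}"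
    proof -
      have "a + (b - a) * s \<le> b \<longleftrightarrow> (b - a) * s \<le> (b - a) * 1" by (simp add: algebra_simps)
      then show ?thesis using ab by (simp add: zero_le_mult_iff)
    qed
    show "ennreal (norm (indicator {0..1} s *\<^sub>R \<phi> s)) = ennreal \<bar>b - a\<bar> * F (a + (b - a) * s)"
    proof (cases "s \<in> {0..1}")
      case True
      then show ?thesis using 1 ab
        by (simp add: F_def \<phi>_def norm_mult nqp line ennreal_mult mult.commute)
    next
      case False
      then show ?thesis using 1 by (simp add: F_def)
    qed
  qed
  also have "\<dots> = (\<integral>\<^sup>+t. F t \<partial>lborel)"
    using nn_integral_real_affine[of F "b - a" a] F_meas ab
    by (subst nn_integral_cmult) (auto)
  finally show ?thesis by (simp add: F_def)
qed

text \<open>The point \<open>Complex x (- y)\<close> is the conjugate of z. Dividing by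
  \<open>w - zc\<close> therefore keeps g holomorphic near the rectangle, and Cauchy's formula at z
  yields 2 pi \<i> g(z) / (2 \<i> y), whose modulus is the left side. The top and left sides are
  reversed so that every parameter increases; the sign disappears in the norm.\<close>

lemma Cauchy_rectangle_bound:
  fixes g :: "complex \<Rightarrow> complex" and S T x y :: real
  assumes hol: "g holomorphic_on {z. Im z > - e}" and e: "e > 0"
    and y: "0 < y" "y < T" and x: "\<bar>x\<bar> < S"
  defines "k \<equiv> \<lambda>w. g w / ((w - Complex x (- y)) * (w - Complex x y))"
  shows "ennreal (pi * cmod (g (Complex x y)) / y)
     \<le> (\<integral>\<^sup>+t. ennreal (cmod (k (Complex t 0))) * indicator {-S..S} t \<partial>lborel)
     + (\<integral>\<^sup>+v. ennreal (cmod (k (Complex S v))) * indicator {0..T} v \<partial>lborel)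
     + (\<integral>\<^sup>+t. ennreal (cmod (k (Complex t T))) * indicator {-S..S} t \<partial>lborel)
     + (\<integral>\<^sup>+v. ennreal (cmod (k (Complex (-S) v))) * indicator {0..T} v \<partial>lborel)"
proof -
  define z where "z = Complex x y"
  define zc where "zc = Complex x (- y)"
  define p1 where "p1 = Complex (-S) 0"
  define p2 where "p2 = Complex S 0"
  define p3 where "p3 = Complex S T"
  define p4 where "p4 = Complex (-S) T"
  \<comment> \<open>With this \<open>m\<close> the half plane \<open>D\<close> lies in the domain of
    g and still excludes \<open>zc\<close>, whose imaginary part is -y.\<close>
  define m where "m = min e y"
  define D where "D = {z. Im z > - m}"
  have m: "m > 0" "m \<le> e" "m \<le> y" using e y by (auto simp: m_def)
  have D: "open D" "convex D" unfolding D_def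
    by (auto intro: open_halfspace_Im_gt convex_halfspace_Im_gt)
  define h where "h w = g w / (w - zc)" for w
  have hol_h: "h holomorphic_on D"
    unfolding h_def by (intro holomorphic_intros holomorphic_on_subset[OF hol])
      (use m in \<open>auto simp: D_def zc_def\<close>)
  have S: "S > 0" using x by auto
  have zbox: "z \<in> box p1 p3" using x y by (auto simp: in_box_complex_iff z_def p1_def p3_def)
  have path: "path_image (rectpath p1 p3) \<subseteq> D - {z}"
  proof -
    have "path_image (rectpath p1 p3) = cbox p1 p3 - box p1 p3"
      by (rule path_image_rectpath_cbox_minus_box) (use S y in \<open>auto simp: p1_def p3_def\<close>)
    moreover have "cbox p1 p3 \<subseteq> D" using m by (auto simp: p1_def p3_def in_cbox_complex_iff D_def)
    ultimately show ?thesis using zbox by blast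
  qed
  have "((\<lambda>w. h w / (w - z)) has_contour_integral
      (2*pi * \<i> * winding_number (rectpath p1 p3) z * h z)) (rectpath p1 p3)"
    using D path y m by (intro Cauchy_integral_formula_convex_simple[OF D(2) hol_h])
       (auto simp: interior_open D_def z_def)
  moreover have k_eq: "(\<lambda>w. h w / (w - z)) = k"
    by (auto simp: h_def k_def z_def zc_def)
  moreover have "winding_number (rectpath p1 p3) z = 1"
    by (rule winding_number_rectpath[OF zbox])
  ultimately have ci: "(k has_contour_integral (2*pi * \<i> * h z)) (rectpath p1 p3)" by simp
  have rp: "rectpath p1 p3 = linepath p1 p2 +++ linepath p2 p3 +++ linepath p3 p4 +++ linepath p4 p1"
    by (simp add: rectpath_def Let_def p1_def p2_def p3_def p4_def)
  have cont: "continuous_on (D - {z}) k"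
  proof -
    have "k holomorphic_on (D - {z})"
      unfolding k_eq[symmetric] by (intro holomorphic_intros holomorphic_on_subset[OF hol_h]) auto
    then show ?thesis by (rule holomorphic_on_imp_continuous_on)
  qed
  have im: "path_image (rectpath p1 p3) = closed_segment p1 p2 \<union> closed_segment p2 p3 \<union>
      closed_segment p3 p4 \<union> closed_segment p4 p1"
    by (simp add: rp path_image_join Un_assoc)
  have sub: "closed_segment p1 p2 \<subseteq> D - {z}" "closed_segment p2 p3 \<subseteq> D - {z}"
      "closed_segment p3 p4 \<subseteq> D - {z}" "closed_segment p4 p1 \<subseteq> D - {z}"
    using path im by auto
  note c = continuous_on_subset[OF cont sub(1)] continuous_on_subset[OF cont sub(2)]
    continuous_on_subset[OF cont sub(3)] continuous_on_subset[OF cont sub(4)]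
  define I where "I = contour_integral (linepath p1 p2) k + contour_integral (linepath p2 p3) k
      - contour_integral (linepath p4 p3) k - contour_integral (linepath p1 p4) k"
  note ii = contour_integrable_continuous_linepath
  have "contour_integral (rectpath p1 p3) k = I"
    unfolding rp I_def
    using c by (simp add: ii contour_integral_reverse_linepath[of p3 p4] contour_integral_reverse_linepath[of p4 p1])
  then have I: "2*pi * \<i> * h z = I" using contour_integral_unique[OF ci] by simp
  have "z - zc = 2 * y * \<i>" by (simp add: z_def zc_def complex_eq_iff)
  then have "cmod (2*pi * \<i> * h z) = pi * cmod (g z) / y"
    using y by (simp add: h_def norm_mult norm_divide)
  then have le: "pi * cmod (g z) / y \<le> cmod (contour_integral (linepath p1 p2) k)
     + cmod (contour_integral (linepath p2 p3) k) + cmod (contour_integral (linepath p4 p3) k)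
     + cmod (contour_integral (linepath p1 p4) k)"
  proof -
    have "cmod (a + b - c - d) \<le> cmod a + cmod b + cmod c + cmod d" for a b c d
      by norm
    from this[of "contour_integral (linepath p1 p2) k" "contour_integral (linepath p2 p3) k"
        "contour_integral (linepath p4 p3) k" "contour_integral (linepath p1 p4) k"]
    show ?thesis unfolding I_def[symmetric] I[symmetric] \<open>cmod (2*pi * \<i> * h z) = pi * cmod (g z) / y\<close> .
  qed
  have c': "continuous_on (closed_segment p4 p3) k" "continuous_on (closed_segment p1 p4) k"
    using c(3,4) by (simp_all add: closed_segment_commute)
  have b1: "ennreal (cmod (contour_integral (linepath p1 p2) k))
     \<le> (\<integral>\<^sup>+t. ennreal (cmod (k (Complex t 0))) * indicator {-S..S} t \<partial>lborel)"
    using norm_contour_integral_segment_le[of "-S" S 1 p1 0 p2 k] S c(1)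
    by (simp add: p1_def p2_def Complex_eq)
  have b2: "ennreal (cmod (contour_integral (linepath p2 p3) k))
     \<le> (\<integral>\<^sup>+v. ennreal (cmod (k (Complex S v))) * indicator {0..T} v \<partial>lborel)"
    using norm_contour_integral_segment_le[of 0 T \<i> p2 "of_real S" p3 k] y c(2)
    by (simp add: p3_def p2_def Complex_eq mult.commute)
  have b3: "ennreal (cmod (contour_integral (linepath p4 p3) k))
     \<le> (\<integral>\<^sup>+t. ennreal (cmod (k (Complex t T))) * indicator {-S..S} t \<partial>lborel)"
    using norm_contour_integral_segment_le[of "-S" S 1 p4 "\<i> * of_real T" p3 k] S c'(1)
    by (simp add: p4_def p3_def Complex_eq add.commute)
  have b4: "ennreal (cmod (contour_integral (linepath p1 p4) k))
     \<le> (\<integral>\<^sup>+v. ennreal (cmod (k (Complex (-S) v))) * indicator {0..T} v \<partial>lborel)"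
    using norm_contour_integral_segment_le[of 0 T \<i> p1 "of_real (-S)" p4 k] y c'(2)
    by (simp add: p1_def p4_def Complex_eq mult.commute)
  have "ennreal (pi * cmod (g z) / y) \<le> ennreal (cmod (contour_integral (linepath p1 p2) k)
     + cmod (contour_integral (linepath p2 p3) k) + cmod (contour_integral (linepath p4 p3) k)
     + cmod (contour_integral (linepath p1 p4) k))"
    by (rule ennreal_leI[OF le])
  also have "\<dots> = ennreal (cmod (contour_integral (linepath p1 p2) k))
     + ennreal (cmod (contour_integral (linepath p2 p3) k))
     + ennreal (cmod (contour_integral (linepath p4 p3) k))
     + ennreal (cmod (contour_integral (linepath p1 p4) k))"
    by (simp add: ennreal_plus)
  also have "\<dots> \<le> (\<integral>\<^sup>+t. ennreal (cmod (k (Complex t 0))) * indicator {-S..S} t \<partial>lborel)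
     + (\<integral>\<^sup>+v. ennreal (cmod (k (Complex S v))) * indicator {0..T} v \<partial>lborel)
     + (\<integral>\<^sup>+t. ennreal (cmod (k (Complex t T))) * indicator {-S..S} t \<partial>lborel)
     + (\<integral>\<^sup>+v. ennreal (cmod (k (Complex (-S) v))) * indicator {0..T} v \<partial>lborel)"
    by (intro add_mono b1 b2 b3 b4)
  finally show ?thesis by (simp add: z_def)
qed

text \<open>The hypothesis \<open>bd\<close> is the only control at infinity. The rectangles have
  height T and half-width S between T and 2 T. The top contributes 4 D / T, a kernel bound 2 / T^2
  times a mass 2 D T. Each vertical side contributes 8 D / T, a kernel bound 4 / T^2 times a mass 2
  D T^2, divided by the length T of the interval of averaging. Together they give the error 20 D /
  T.\<close>

lemma Poisson_majorant:
  fixes g :: "complex \<Rightarrow> complex" and x y D e :: real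
  assumes hol: "g holomorphic_on {z. Im z > - e}" and e: "e > 0" and y: "y > 0" and D: "D \<ge> 0"
    and bd: "\<And>v s. v \<ge> 0 \<Longrightarrow> s \<ge> 1 \<Longrightarrow>
      (\<integral>\<^sup>+t. ennreal (cmod (g (Complex t v))) * indicator {-s..s} t \<partial>lborel) \<le> ennreal (D * s)"
  shows "ennreal (pi * cmod (g (Complex x y)) / y)
    \<le> (\<integral>\<^sup>+t. ennreal (cmod (g (Complex t 0)) / ((t - x)\<^sup>2 + y\<^sup>2)) \<partial>lborel)" (is "ennreal ?L \<le> ?A")
proof -
  \<comment> \<open>\<open>max 0 v\<close> continues the slices constantly below the real axis, so
    \<open>H\<close> is continuous on the whole plane and jointly measurable, as Fubini
    requires.\<close>
  define H where "H s v = ennreal (cmod (g (Complex s (max 0 v))))" for s v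
  have contg: "continuous_on {z. Im z > - e} g"
    using hol by (rule holomorphic_on_imp_continuous_on)
  have H_meas: "(\<lambda>(s, v). H (\<sigma> * s) v) \<in> borel_measurable (lborel \<Otimes>\<^sub>M lborel)" for \<sigma> :: real
  proof -
    have "continuous_on UNIV (\<lambda>p::real \<times> real. cmod (g (Complex (\<sigma> * fst p) (max 0 (snd p)))))"
      unfolding Complex_eq using e
      by (intro continuous_intros continuous_on_compose2[OF contg]) auto
    then have "(\<lambda>p::real \<times> real. cmod (g (Complex (\<sigma> * fst p) (max 0 (snd p))))) \<in> borel_measurable borel"
      by (rule borel_measurable_continuous_onI)
    then have "(\<lambda>p::real \<times> real. ennreal (cmod (g (Complex (\<sigma> * fst p) (max 0 (snd p)))))) \<in> borel_measurable borel"
      by measurable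
    then show ?thesis by (simp add: lborel_prod H_def split_beta)
  qed
  have H_meas': "(\<lambda>s. H (\<sigma> * s) v) \<in> borel_measurable lborel" for \<sigma> v
    using measurable_compose[OF measurable_Pair2'[of v lborel lborel] H_meas[of \<sigma>]] by simp
  have H_meas1[measurable]: "(\<lambda>s. H s v) \<in> borel_measurable borel" for v
    using H_meas'[of 1 v] by simp
  have H_meas2[measurable]: "(\<lambda>v. H s v) \<in> borel_measurable borel" for s
  proof -
    have "(\<lambda>v. H (1 * s) v) \<in> borel_measurable lborel"
      using measurable_compose[OF measurable_Pair1'[of s lborel lborel] H_meas[of 1]] by simp
    then show ?thesis by simp
  qed
  define G where "G T s = (\<integral>\<^sup>+v. H s v * indicator {0..T} v \<partial>lborel)" for T s
  have G_meas: "(\<lambda>s. G T (\<sigma> * s)) \<in> borel_measurable lborel" for T \<sigma>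
  proof -
    have [measurable]: "(\<lambda>(s, v). H (\<sigma> * s) v) \<in> borel_measurable (lborel \<Otimes>\<^sub>M lborel)" by (rule H_meas)
    show ?thesis unfolding G_def by measurable
  qed
  have side: "(\<integral>\<^sup>+s. G T (\<sigma> * s) * indicator {T..2*T} s \<partial>lborel) \<le> ennreal (2 * D * T\<^sup>2)"
    if T: "T \<ge> 1" and \<sigma>: "\<sigma> = 1 \<or> \<sigma> = -1" for T \<sigma> :: real
  proof -
    have [measurable]: "(\<lambda>(s, v). H (\<sigma> * s) v) \<in> borel_measurable (lborel \<Otimes>\<^sub>M lborel)" by (rule H_meas)
    have "(\<integral>\<^sup>+s. G T (\<sigma> * s) * indicator {T..2*T} s \<partial>lborel)
        = (\<integral>\<^sup>+s. \<integral>\<^sup>+v. H (\<sigma> * s) v * indicator {0..T} v * indicator {T..2*T} s \<partial>lborel \<partial>lborel)"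
      unfolding G_def by (intro nn_integral_cong nn_integral_multc[symmetric]) measurable
    also have "\<dots> = (\<integral>\<^sup>+v. \<integral>\<^sup>+s. H (\<sigma> * s) v * indicator {0..T} v * indicator {T..2*T} s \<partial>lborel \<partial>lborel)"
      by (rule lborel_pair.Fubini'[symmetric]) measurable
    also have "\<dots> \<le> (\<integral>\<^sup>+v. ennreal (D * (2 * T)) * indicator {0..T} v \<partial>lborel)"
    proof (rule nn_integral_mono)
      fix v :: real
      show "(\<integral>\<^sup>+s. H (\<sigma> * s) v * indicator {0..T} v * indicator {T..2*T} s \<partial>lborel)
          \<le> ennreal (D * (2 * T)) * indicator {0..T} v"
      proof (cases "v \<in> {0..T}")
        case True
        have "(\<integral>\<^sup>+s. H (\<sigma> * s) v * indicator {0..T} v * indicator {T..2*T} s \<partial>lborel)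
           \<le> (\<integral>\<^sup>+s. H (0 + \<sigma> * s) v * indicator {-(2*T)..2*T} (0 + \<sigma> * s) \<partial>lborel)"
          using \<sigma> T by (intro nn_integral_mono) (auto simp: indicator_def)
        also have "\<dots> = (\<integral>\<^sup>+s. H s v * indicator {-(2*T)..2*T} s \<partial>lborel)"
          using nn_integral_real_affine[of "\<lambda>s. H s v * indicator {-(2*T)..2*T} s" \<sigma> 0] \<sigma> by auto
        also have "\<dots> \<le> ennreal (D * (2 * T))"
          using bd[of v "2 * T"] True T by (simp add: H_def)
        finally show ?thesis using True by simp
      qed simp
    qed
    also have "\<dots> = ennreal (2 * D * T\<^sup>2)"
      using T D by (subst nn_integral_cmult_indicator) (simp_all add: ennreal_mult[symmetric] power2_eq_square mult_ac)
    finally show ?thesis .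
  qed
  text \<open>No pointwise decay of \<open>g\<close> is available on the vertical sides of the rectangle; the line
    bounds control them only after averaging over the half-width \<open>S\<close> in \<open>{T..2*T}\<close>.\<close>
  have est: "ennreal ?L \<le> ?A + ennreal (20 * D / T)"
    if T: "T \<ge> 1" "T \<ge> 2 * \<bar>x\<bar> + 1" "T \<ge> 2 * y" for T
  proof -
    have rect: "ennreal ?L \<le> ?A + ennreal (4 * D / T) + ennreal (4 / T\<^sup>2) * (G T (1 * S) + G T ((-1) * S))"
      if S: "S \<in> {T..2*T}" for S
    proof -
      define k where "k w = g w / ((w - Complex x (- y)) * (w - Complex x y))" for w
      have bottom: "(\<integral>\<^sup>+t. ennreal (cmod (k (Complex t 0))) * indicator {-S..S} t \<partial>lborel) \<le> ?A"
      proof (rule nn_integral_mono)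
        fix t
        have "cmod (Complex t 0 - Complex x (- y)) * cmod (Complex t 0 - Complex x y) = (t - x)\<^sup>2 + y\<^sup>2"
          by (simp add: cmod_def)
        then have "cmod (k (Complex t 0)) = cmod (g (Complex t 0)) / ((t - x)\<^sup>2 + y\<^sup>2)"
          by (simp only: k_def norm_divide norm_mult)
        then show "ennreal (cmod (k (Complex t 0))) * indicator {-S..S} t
            \<le> ennreal (cmod (g (Complex t 0)) / ((t - x)\<^sup>2 + y\<^sup>2))"
          by (auto simp: indicator_def)
      qed
      have top: "(\<integral>\<^sup>+t. ennreal (cmod (k (Complex t T))) * indicator {-S..S} t \<partial>lborel) \<le> ennreal (4 * D / T)"
      proof -
        have kb: "cmod (k (Complex t T)) \<le> 2 / T\<^sup>2 * cmod (g (Complex t T))" for t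
        proof -
          have "T \<le> cmod (Complex t T - Complex x (- y))"
            using abs_Im_le_cmod[of "Complex t T - Complex x (- y)"] T y by simp
          moreover have "T / 2 \<le> cmod (Complex t T - Complex x y)"
            using abs_Im_le_cmod[of "Complex t T - Complex x y"] T y by simp
          ultimately have "T * (T / 2) \<le> cmod (Complex t T - Complex x (- y)) * cmod (Complex t T - Complex x y)"
            using T by (intro mult_mono) auto
          then have "cmod (g (Complex t T)) / (cmod (Complex t T - Complex x (- y)) * cmod (Complex t T - Complex x y))
             \<le> cmod (g (Complex t T)) / (T * (T / 2))"
            using T y by (intro divide_left_mono mult_pos_pos) (auto simp: complex_eq_iff)
          then show ?thesis by (simp add: k_def norm_divide norm_mult power2_eq_square mult_ac)
        qed
        have "(\<integral>\<^sup>+t. ennreal (cmod (k (Complex t T))) * indicator {-S..S} t \<partial>lborel)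
           \<le> (\<integral>\<^sup>+t. ennreal (2 / T\<^sup>2) * (H t T * indicator {-S..S} t) \<partial>lborel)"
          using kb T by (intro nn_integral_mono)
            (auto simp: indicator_def H_def ennreal_mult'[symmetric] intro!: ennreal_leI)
        also have "\<dots> = ennreal (2 / T\<^sup>2) * (\<integral>\<^sup>+t. H t T * indicator {-S..S} t \<partial>lborel)"
          by (rule nn_integral_cmult) measurable
        also have "\<dots> \<le> ennreal (2 / T\<^sup>2) * ennreal (D * S)"
          using bd[of T S] T S by (intro mult_left_mono) (auto simp: H_def)
        also have "\<dots> \<le> ennreal (2 / T\<^sup>2 * (D * (2 * T)))"
          using S by (subst ennreal_mult'[symmetric], simp, intro ennreal_leI mult_left_mono D) auto
        also have "2 / T\<^sup>2 * (D * (2 * T)) = 4 * D / T"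
          using T by (simp add: field_simps power2_eq_square)
        finally show ?thesis .
      qed
      have "(\<integral>\<^sup>+v. ennreal (cmod (k (Complex (\<sigma> * S) v))) * indicator {0..T} v \<partial>lborel)
          \<le> ennreal (4 / T\<^sup>2) * G T (\<sigma> * S)" if \<sigma>: "\<sigma> = 1 \<or> \<sigma> = -1" for \<sigma>
      proof -
        have kb: "cmod (k (Complex (\<sigma> * S) v)) \<le> 4 / T\<^sup>2 * cmod (g (Complex (\<sigma> * S) v))" for v
        proof -
          have *: "T / 2 \<le> cmod (Complex (\<sigma> * S) v - Complex x u)" for u
            using abs_Re_le_cmod[of "Complex (\<sigma> * S) v - Complex x u"] T S \<sigma> by auto
          then have "(T / 2) * (T / 2) \<le> cmod (Complex (\<sigma> * S) v - Complex x (- y)) * cmod (Complex (\<sigma> * S) v - Complex x y)"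
            using T by (intro mult_mono) auto
          moreover have "0 < cmod (Complex (\<sigma> * S) v - Complex x u)" for u
            using *[of u] T by linarith
          ultimately have "cmod (g (Complex (\<sigma> * S) v)) / (cmod (Complex (\<sigma> * S) v - Complex x (- y)) * cmod (Complex (\<sigma> * S) v - Complex x y))
             \<le> cmod (g (Complex (\<sigma> * S) v)) / ((T / 2) * (T / 2))"
            using T by (intro divide_left_mono mult_pos_pos) auto
          then show ?thesis by (simp add: k_def norm_divide norm_mult power2_eq_square mult_ac)
        qed
        have "(\<integral>\<^sup>+v. ennreal (cmod (k (Complex (\<sigma> * S) v))) * indicator {0..T} v \<partial>lborel)
           \<le> (\<integral>\<^sup>+v. ennreal (4 / T\<^sup>2) * (H (\<sigma> * S) v * indicator {0..T} v) \<partial>lborel)"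
          using kb T by (intro nn_integral_mono)
            (auto simp: indicator_def H_def ennreal_mult'[symmetric] intro!: ennreal_leI)
        also have "\<dots> = ennreal (4 / T\<^sup>2) * G T (\<sigma> * S)"
          unfolding G_def by (rule nn_integral_cmult) measurable
        finally show ?thesis .
      qed
      from this[of 1] this[of "-1"]
      have sides: "(\<integral>\<^sup>+v. ennreal (cmod (k (Complex S v))) * indicator {0..T} v \<partial>lborel) \<le> ennreal (4 / T\<^sup>2) * G T (1 * S)"
        "(\<integral>\<^sup>+v. ennreal (cmod (k (Complex (-S) v))) * indicator {0..T} v \<partial>lborel) \<le> ennreal (4 / T\<^sup>2) * G T ((-1) * S)"
        by simp_all
      have "ennreal ?L
         \<le> (\<integral>\<^sup>+t. ennreal (cmod (k (Complex t 0))) * indicator {-S..S} t \<partial>lborel)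
         + (\<integral>\<^sup>+v. ennreal (cmod (k (Complex S v))) * indicator {0..T} v \<partial>lborel)
         + (\<integral>\<^sup>+t. ennreal (cmod (k (Complex t T))) * indicator {-S..S} t \<partial>lborel)
         + (\<integral>\<^sup>+v. ennreal (cmod (k (Complex (-S) v))) * indicator {0..T} v \<partial>lborel)"
        unfolding k_def by (rule Cauchy_rectangle_bound[OF hol e]) (use y T S in auto)
      also have "\<dots> \<le> ?A + ennreal (4 / T\<^sup>2) * G T (1 * S) + ennreal (4 * D / T)
          + ennreal (4 / T\<^sup>2) * G T ((-1) * S)"
        by (intro add_mono bottom top sides)
      finally show ?thesis by (simp add: distrib_left add_ac)
    qed
    define u where "u \<sigma> S = G T (\<sigma> * S) * indicator {T..2*T} S" for \<sigma> S
    have [measurable]: "(\<lambda>s. u \<sigma> s) \<in> borel_measurable lborel" for \<sigma>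
      unfolding u_def using G_meas[of T \<sigma>] by simp
    have "ennreal T * ennreal ?L = (\<integral>\<^sup>+S. ennreal ?L * indicator {T..2*T} S \<partial>lborel)"
      using T by (subst nn_integral_cmult_indicator) (simp_all add: mult.commute)
    also have "\<dots> \<le> (\<integral>\<^sup>+S. (?A + ennreal (4 * D / T)) * indicator {T..2*T} S
        + ennreal (4 / T\<^sup>2) * (u 1 S + u (-1) S) \<partial>lborel)"
    proof (rule nn_integral_mono)
      fix S
      show "ennreal ?L * indicator {T..2*T} S \<le> (?A + ennreal (4 * D / T)) * indicator {T..2*T} S
        + ennreal (4 / T\<^sup>2) * (u 1 S + u (-1) S)"
        using rect[of S] by (cases "S \<in> {T..2*T}") (auto simp: u_def add_ac)
    qed
    also have "\<dots> = (\<integral>\<^sup>+S. (?A + ennreal (4 * D / T)) * indicator {T..2*T} S \<partial>lborel)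
        + (\<integral>\<^sup>+S. ennreal (4 / T\<^sup>2) * (u 1 S + u (-1) S) \<partial>lborel)"
      by (rule nn_integral_add) measurable
    also have "(\<integral>\<^sup>+S. (?A + ennreal (4 * D / T)) * indicator {T..2*T} S \<partial>lborel) = (?A + ennreal (4 * D / T)) * ennreal T"
      using T by (subst nn_integral_cmult_indicator) simp_all
    also have "(\<integral>\<^sup>+S. ennreal (4 / T\<^sup>2) * (u 1 S + u (-1) S) \<partial>lborel)
        = ennreal (4 / T\<^sup>2) * (\<integral>\<^sup>+S. (u 1 S + u (-1) S) \<partial>lborel)"
      by (rule nn_integral_cmult) measurable
    also have "(\<integral>\<^sup>+S. (u 1 S + u (-1) S) \<partial>lborel) = (\<integral>\<^sup>+S. u 1 S \<partial>lborel) + (\<integral>\<^sup>+S. u (-1) S \<partial>lborel)"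
      by (rule nn_integral_add) measurable
    also have "(?A + ennreal (4 * D / T)) * ennreal T + ennreal (4 / T\<^sup>2) * ((\<integral>\<^sup>+S. u 1 S \<partial>lborel) + (\<integral>\<^sup>+S. u (-1) S \<partial>lborel))
        \<le> (?A + ennreal (4 * D / T)) * ennreal T + ennreal (4 / T\<^sup>2) * (ennreal (2 * D * T\<^sup>2) + ennreal (2 * D * T\<^sup>2))"
      unfolding u_def by (intro add_mono mult_left_mono side order_refl) (use T in auto)
    also have "ennreal (4 / T\<^sup>2) * (ennreal (2 * D * T\<^sup>2) + ennreal (2 * D * T\<^sup>2)) = ennreal T * ennreal (16 * D / T)"
      using T D by (simp add: ennreal_plus[symmetric] ennreal_mult'[symmetric] ennreal_mult''[symmetric] field_simps del: ennreal_plus)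
    also have "(?A + ennreal (4 * D / T)) * ennreal T + \<dots> = ennreal T * (?A + (ennreal (4 * D / T) + ennreal (16 * D / T)))"
      by (simp add: algebra_simps)
    also have "ennreal (4 * D / T) + ennreal (16 * D / T) = ennreal (20 * D / T)"
      using T D by (simp add: ennreal_plus[symmetric] field_simps del: ennreal_plus)
    finally show ?thesis
      using T by (subst (asm) ennreal_mult_le_mult_iff) auto
  qed
  show ?thesis
  proof (cases "?A = top")
    case False
    then obtain \<alpha> where \<alpha>: "\<alpha> \<ge> 0" "?A = ennreal \<alpha>" by (cases ?A) auto
    have "?L \<le> \<alpha> + d" if d: "d > 0" for d
    proof -
      define T where "T = Max {1, 2 * \<bar>x\<bar> + 1, 2 * y, 20 * D / d}"
      have T: "T \<ge> 1" "T \<ge> 2 * \<bar>x\<bar> + 1" "T \<ge> 2 * y" "T \<ge> 20 * D / d" by (auto simp: T_def)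
      have "ennreal ?L \<le> ennreal (\<alpha> + 20 * D / T)"
        using est[OF T(1-3)] \<alpha> D T by (simp add: ennreal_plus[symmetric] del: ennreal_plus)
      then have "?L \<le> \<alpha> + 20 * D / T" using \<alpha>(1) D T by (subst (asm) ennreal_le_iff) auto
      also have "20 * D / T \<le> d" using T d by (simp add: field_simps)
      finally show ?thesis by simp
    qed
    then have "?L \<le> \<alpha>" by (rule field_le_epsilon)
    then show ?thesis by (simp only: \<alpha> ennreal_leI)
  qed simp
qed

section \<open>Covering and the weak type inequality\<close>

text \<open>Vitali's selection leaves disjoint balls whose fivefold enlargements, of length
  \<open>10 * r j\<close>, cover A. Each such length times c is less than ten times the mass of h on
  the small ball, and by disjointness these masses add up to at most the total.\<close>

lemma ball_average_weak_type:
  fixes h :: "real \<Rightarrow> ennreal" and A :: "real set" and c :: real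
  assumes h[measurable]: "h \<in> borel_measurable lborel" and c: "c > 0"
    and avg: "\<And>x. x \<in> A \<Longrightarrow> \<exists>r>0. ennreal (c * r) < (\<integral>\<^sup>+t. h t * indicator (ball x r) t \<partial>lborel)"
  shows "ennreal c * emeasure lborel A \<le> 10 * (\<integral>\<^sup>+t. h t \<partial>lborel)"
proof (cases "(\<integral>\<^sup>+t. h t \<partial>lborel) = top")
  case True
  then show ?thesis by (simp add: ennreal_mult_top)
next
  case False
  then obtain I where I: "I \<ge> 0" "(\<integral>\<^sup>+t. h t \<partial>lborel) = ennreal I"
    by (cases "\<integral>\<^sup>+t. h t \<partial>lborel") auto
  obtain r where r: "\<And>x. x \<in> A \<Longrightarrow> r x > 0"
      "\<And>x. x \<in> A \<Longrightarrow> ennreal (c * r x) < (\<integral>\<^sup>+t. h t * indicator (ball x (r x)) t \<partial>lborel)"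
    using avg by metis
  \<comment> \<open>Vitali's lemma needs bounded radii; the finite total mass \<open>I\<close>
    supplies the bound.\<close>
  have bound: "r x \<le> I / c" if "x \<in> A" for x
  proof -
    have "(\<integral>\<^sup>+t. h t * indicator (ball x (r x)) t \<partial>lborel) \<le> ennreal I"
      unfolding I(2)[symmetric] by (intro nn_integral_mono) (auto simp: indicator_def)
    then have "ennreal (c * r x) \<le> ennreal I" using r(2)[OF that] by simp
    then have "c * r x \<le> I" using I(1) by (simp add: ennreal_le_iff)
    then show ?thesis using c by (simp add: field_simps)
  qed
  have rb: "0 < r x \<and> r x \<le> I / c" if "x \<in> A" for x
    using r(1) bound that by auto
  obtain C where C: "countable C" "C \<subseteq> A"
     "pairwise (\<lambda>i j. disjnt (cball i (r i)) (cball j (r j))) C"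
     "\<And>i. i \<in> A \<Longrightarrow> \<exists>j. j \<in> C \<and> \<not> disjnt (cball i (r i)) (cball j (r j)) \<and>
                        cball i (r i) \<subseteq> ball j (5 * r j)"
    by (rule Vitali_covering_lemma_cballs_balls[of A r "I / c" "\<lambda>x. x", OF rb]; (assumption | (rule that; assumption)))
  have cover: "A \<subseteq> (\<Union>j\<in>C. ball j (5 * r j))"
  proof
    fix x assume x: "x \<in> A"
    then obtain j where "j \<in> C" "cball x (r x) \<subseteq> ball j (5 * r j)" using C(4) by blast
    moreover have "x \<in> cball x (r x)" using r(1)[OF x] by simp
    ultimately show "x \<in> (\<Union>j\<in>C. ball j (5 * r j))" by blast
  qed
  have U: "(\<Union>j\<in>C. ball j (5 * r j)) \<in> sets borel"
    by (intro borel_open open_UN ballI open_ball)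
  have "emeasure lborel A \<le> emeasure lborel (\<Union>j\<in>C. ball j (5 * r j))"
    using cover U by (intro emeasure_mono) simp_all
  also have "\<dots> = (\<integral>\<^sup>+t. indicator (\<Union>j\<in>C. ball j (5 * r j)) t \<partial>lborel)"
    by (rule nn_integral_indicator[symmetric]) (simp add: U)
  \<comment> \<open>Sums over the countable set \<open>C\<close> are written as integrals over
    \<open>count_space C\<close>, so that they can be exchanged with the integral over t.\<close>
  also have "\<dots> \<le> (\<integral>\<^sup>+t. \<integral>\<^sup>+j. indicator (ball j (5 * r j)) t \<partial>count_space C \<partial>lborel)"
  proof (rule nn_integral_mono)
    fix t :: real
    show "indicator (\<Union>j\<in>C. ball j (5 * r j)) t \<le> (\<integral>\<^sup>+j. indicator (ball j (5 * r j)) t \<partial>count_space C)"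
    proof (cases "t \<in> (\<Union>j\<in>C. ball j (5 * r j))")
      case True
      then obtain j where "j \<in> C" "t \<in> ball j (5 * r j)" by blast
      then show ?thesis
        using nn_integral_ge_point[of j C "\<lambda>j. indicator (ball j (5 * r j)) t"] True by simp
    qed simp
  qed
  also have "\<dots> = (\<integral>\<^sup>+j. \<integral>\<^sup>+t. indicator (ball j (5 * r j)) t \<partial>lborel \<partial>count_space C)"
    by (rule nn_integral_count_space_nn_integral[OF C(1)]) (intro borel_measurable_indicator, simp)
  also have "\<dots> = (\<integral>\<^sup>+j. ennreal (10 * r j) \<partial>count_space C)"
  proof (rule nn_integral_cong)
    fix j assume "j \<in> space (count_space C)"
    then have "r j > 0" using C(2) r(1) by auto
    then show "(\<integral>\<^sup>+t. indicator (ball j (5 * r j)) t \<partial>lborel) = ennreal (10 * r j)"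
      by (simp add: ball_eq_greaterThanLessThan)
  qed
  finally have "ennreal c * emeasure lborel A \<le> ennreal c * (\<integral>\<^sup>+j. ennreal (10 * r j) \<partial>count_space C)"
    by (rule mult_left_mono) simp
  also have "\<dots> = (\<integral>\<^sup>+j. ennreal c * ennreal (10 * r j) \<partial>count_space C)"
    by (rule nn_integral_cmult[symmetric]) simp
  also have "\<dots> \<le> (\<integral>\<^sup>+j. 10 * (\<integral>\<^sup>+t. h t * indicator (ball j (r j)) t \<partial>lborel) \<partial>count_space C)"
  proof (rule nn_integral_mono)
    fix j assume "j \<in> space (count_space C)"
    then have j: "j \<in> A" using C(2) by auto
    have "ennreal c * ennreal (10 * r j) = 10 * ennreal (c * r j)"
      using c r(1)[OF j] by (simp add: ennreal_mult' mult_ac)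
    also have "\<dots> \<le> 10 * (\<integral>\<^sup>+t. h t * indicator (ball j (r j)) t \<partial>lborel)"
      using r(2)[OF j] by (intro mult_left_mono) auto
    finally show "ennreal c * ennreal (10 * r j) \<le> 10 * (\<integral>\<^sup>+t. h t * indicator (ball j (r j)) t \<partial>lborel)" .
  qed
  also have "\<dots> = 10 * (\<integral>\<^sup>+j. \<integral>\<^sup>+t. h t * indicator (ball j (r j)) t \<partial>lborel \<partial>count_space C)"
    by (rule nn_integral_cmult) simp
  \<comment> \<open>Read as values of the measure \<open>density lborel h\<close>, the masses of the
    disjoint balls are added by countable additivity.\<close>
  also have "(\<integral>\<^sup>+j. \<integral>\<^sup>+t. h t * indicator (ball j (r j)) t \<partial>lborel \<partial>count_space C)
      = (\<integral>\<^sup>+j. emeasure (density lborel h) (ball j (r j)) \<partial>count_space C)"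
    by (intro nn_integral_cong) (simp add: emeasure_density)
  also have "\<dots> = emeasure (density lborel h) (\<Union>j\<in>C. ball j (r j))"
  proof (rule emeasure_UN_countable[symmetric])
    show "disjoint_family_on (\<lambda>j. ball j (r j)) C"
      using C(3) unfolding disjoint_family_on_def pairwise_def disjnt_def
      by (meson ball_subset_cball disjoint_iff subset_iff)
  qed (use C(1) in auto)
  also have "\<dots> \<le> (\<integral>\<^sup>+t. h t \<partial>lborel)"
  proof -
    have "open (\<Union>j\<in>C. ball j (r j))" by (intro open_UN ballI open_ball)
    then have "(\<Union>j\<in>C. ball j (r j)) \<in> sets lborel" by simp
    then show ?thesis
      by (subst emeasure_density) (auto intro!: nn_integral_mono simp: indicator_def)
  qed
  finally show ?thesis by (simp add: mult_left_mono)
qed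

text \<open>The averages are centred at the vertex x, the kernel at x'; since |x' - x| < y the
  discrepancy costs a constant only. Around x the line is cut at the radii 2^n y: on the n-th shell
  the kernel is at most 16 / (y^2 4^n), while the ball of that radius has mass at most c 2^n y. The
  resulting geometric series 16 c / y * (1/2)^n has sum 32 c / y.\<close>

lemma Poisson_le_ball_averages:
  fixes h :: "real \<Rightarrow> ennreal" and c x x' y :: real
  assumes h[measurable]: "h \<in> borel_measurable lborel" and y: "y > 0" and xx: "\<bar>x' - x\<bar> < y" and c: "c \<ge> 0"
    and avg: "\<And>r. r > 0 \<Longrightarrow> (\<integral>\<^sup>+t. h t * indicator (ball x r) t \<partial>lborel) \<le> ennreal (c * r)"
  shows "(\<integral>\<^sup>+t. h t * ennreal (1 / ((t - x')\<^sup>2 + y\<^sup>2)) \<partial>lborel) \<le> ennreal (32 * c / y)"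
proof -
  have kernel: "\<exists>n. \<bar>t - x\<bar> < 2 ^ n * y \<and> 1 / ((t - x')\<^sup>2 + y\<^sup>2) \<le> 16 / (y\<^sup>2 * 4 ^ n)" for t
  proof -
    define n where "n = (LEAST n. \<bar>t - x\<bar> < 2 ^ n * y)"
    obtain m where "\<bar>t - x\<bar> / y < 2 ^ m" using real_arch_pow[of 2 "\<bar>t - x\<bar> / y"] by auto
    then have "\<bar>t - x\<bar> < 2 ^ m * y" using y by (simp add: field_simps)
    then have n: "\<bar>t - x\<bar> < 2 ^ n * y" unfolding n_def by (rule LeastI)
    have "y\<^sup>2 * 4 ^ n \<le> 16 * ((t - x')\<^sup>2 + y\<^sup>2)"
    \<comment> \<open>For n at most 2 the summand y^2 of the denominator suffices. From n = 3 on,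
      minimality of n gives |t - x| \<ge> 2^(n-1) y, and moving the centre to x' loses less than y,
      which leaves at least 2^(n-2) y.\<close>
    proof (cases "n < 3")
      case True
      then have "(4::real) ^ n \<le> 4 ^ 2" by (intro power_increasing) auto
      then have "y\<^sup>2 * 4 ^ n \<le> y\<^sup>2 * 16" by (intro mult_left_mono) auto
      moreover have "0 \<le> 16 * (t - x')\<^sup>2" by simp
      ultimately show ?thesis unfolding distrib_left by linarith
    next
      case False
      define k where "k = n - 2"
      have k: "n = Suc (Suc k)" "k \<ge> 1" using False by (auto simp: k_def)
      have "\<not> \<bar>t - x\<bar> < 2 ^ (Suc k) * y"
        using not_less_Least[of "Suc k" "\<lambda>n. \<bar>t - x\<bar> < 2 ^ n * y"] k by (simp add: n_def)
      moreover have "(2::real) ^ k \<ge> 1" by simp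
      then have "y \<le> 2 ^ k * y" using y by simp
      ultimately have "2 ^ k * y \<le> \<bar>t - x'\<bar>" using xx by (simp add: algebra_simps)
      then have "(2 ^ k * y)\<^sup>2 \<le> (t - x')\<^sup>2" using y by (metis abs_le_square_iff abs_of_pos zero_less_mult_iff zero_less_numeral zero_less_power)
      moreover have "(2 ^ k * y)\<^sup>2 * 16 = y\<^sup>2 * 4 ^ n"
        by (simp add: k power_mult_distrib power2_eq_square flip: power_mult_distrib)
      ultimately show ?thesis using zero_le_power2[of y] unfolding distrib_left by linarith
    qed
    moreover have "(t - x')\<^sup>2 + y\<^sup>2 > 0" using y by (simp add: sum_power2_gt_zero_iff)
    ultimately have "1 / ((t - x')\<^sup>2 + y\<^sup>2) \<le> 16 / (y\<^sup>2 * 4 ^ n)"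
      using y by (simp add: field_simps)
    then show ?thesis using n by blast
  qed
  have [measurable]: "(\<lambda>t. indicator (ball x r) t :: ennreal) \<in> borel_measurable borel" for r
    by (intro borel_measurable_indicator) simp
  define q where "q n = 16 / (y\<^sup>2 * 4 ^ n)" for n :: nat
  have q: "q n \<ge> 0" for n by (simp add: q_def)
  have "(\<integral>\<^sup>+t. h t * ennreal (1 / ((t - x')\<^sup>2 + y\<^sup>2)) \<partial>lborel)
      \<le> (\<integral>\<^sup>+t. \<integral>\<^sup>+n. ennreal (q n) * (h t * indicator (ball x (2 ^ n * y)) t) \<partial>count_space UNIV \<partial>lborel)"
  proof (rule nn_integral_mono)
    fix t :: real
    obtain n where n: "\<bar>t - x\<bar> < 2 ^ n * y" "1 / ((t - x')\<^sup>2 + y\<^sup>2) \<le> q n"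
      using kernel[of t] by (auto simp: q_def)
    have "h t * ennreal (1 / ((t - x')\<^sup>2 + y\<^sup>2)) \<le> h t * ennreal (q n)"
      by (intro mult_left_mono ennreal_leI n(2)) simp
    also have "\<dots> = ennreal (q n) * (h t * indicator (ball x (2 ^ n * y)) t)"
      using n(1) by (simp add: indicator_def dist_real_def abs_minus_commute mult.commute)
    also have "\<dots> \<le> (\<integral>\<^sup>+n. ennreal (q n) * (h t * indicator (ball x (2 ^ n * y)) t) \<partial>count_space UNIV)"
      by (rule nn_integral_ge_point) simp
    finally show "h t * ennreal (1 / ((t - x')\<^sup>2 + y\<^sup>2))
        \<le> (\<integral>\<^sup>+n. ennreal (q n) * (h t * indicator (ball x (2 ^ n * y)) t) \<partial>count_space UNIV)" .
  qed
  also have "\<dots> = (\<integral>\<^sup>+n. \<integral>\<^sup>+t. ennreal (q n) * (h t * indicator (ball x (2 ^ n * y)) t) \<partial>lborel \<partial>count_space UNIV)"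
    by (rule nn_integral_count_space_nn_integral) (simp, measurable)
  also have "\<dots> \<le> (\<integral>\<^sup>+n. ennreal (16 * c / y * (1/2) ^ n) \<partial>count_space UNIV)"
  proof (rule nn_integral_mono)
    fix n :: nat
    have "(\<integral>\<^sup>+t. ennreal (q n) * (h t * indicator (ball x (2 ^ n * y)) t) \<partial>lborel)
       = ennreal (q n) * (\<integral>\<^sup>+t. h t * indicator (ball x (2 ^ n * y)) t \<partial>lborel)"
      by (rule nn_integral_cmult) measurable
    also have "\<dots> \<le> ennreal (q n) * ennreal (c * (2 ^ n * y))"
      using y by (intro mult_left_mono avg) auto
    also have "\<dots> = ennreal (q n * (c * (2 ^ n * y)))" using q by (simp add: ennreal_mult')
    also have "q n * (c * (2 ^ n * y)) = 16 * c / y * (1/2) ^ n"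
    proof -
      have "(4::real) ^ n = 2 ^ n * 2 ^ n" by (simp flip: power_mult_distrib)
      then show ?thesis using y by (simp add: q_def power2_eq_square power_divide field_simps)
    qed
    finally show "(\<integral>\<^sup>+t. ennreal (q n) * (h t * indicator (ball x (2 ^ n * y)) t) \<partial>lborel)
       \<le> ennreal (16 * c / y * (1/2) ^ n)" .
  qed
  also have "\<dots> = (\<Sum>n. ennreal (16 * c / y * (1/2) ^ n))" by (rule nn_integral_count_space_nat)
  also have "\<dots> = ennreal (32 * c / y)"
  proof (rule suminf_ennreal_eq)
    show "0 \<le> 16 * c / y * (1/2) ^ n" for n using c y by simp
    have "(\<lambda>n. 16 * c / y * (1/2) ^ n) sums (16 * c / y * (1 / (1 - 1/2)))"
      by (intro sums_mult geometric_sums) simp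
    then show "(\<lambda>n. 16 * c / y * (1/2) ^ n) sums (32 * c / y)" by simp
  qed
  finally show ?thesis .
qed

text \<open>Cones and balls are dual: z lies in \<open>cone x\<close> exactly when x lies in
  \<open>ball (Re z) (Im z)\<close>. This makes the level sets of nontangential suprema
  Borel.\<close>

lemma open_nontangential_level: "open {x. \<exists>z\<in>cone x. P z}"
proof -
  have "{x. \<exists>z\<in>cone x. P z} = (\<Union>z\<in>{z. P z}. ball (Re z) (Im z))"
    by (auto simp: cone_def dist_real_def)
  then show ?thesis by auto
qed

text \<open>Suppose all averages of the truncated function h around x were small. The part of |g|
  below l / 128 adds at most l / 128 * 2 r = l / 64 * r to the mass of a ball of radius r, so l / 32
  * r bounds the mass of |g| itself. The Poisson majorant then gives pi |g(z)| \<le> l, against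
  |g(z)| > l. Hence the covering lemma applies with c = l / 64, and 640 is 64 times its factor
  10.\<close>

lemma nontangential_weak_type:
  fixes g :: "complex \<Rightarrow> complex" and D e l :: real
  assumes hol: "g holomorphic_on {z. Im z > - e}" and e: "e > 0" and D: "D \<ge> 0" and l: "l > 0"
    and bd: "\<And>v s. v \<ge> 0 \<Longrightarrow> s \<ge> 1 \<Longrightarrow>
      (\<integral>\<^sup>+t. ennreal (cmod (g (Complex t v))) * indicator {-s..s} t \<partial>lborel) \<le> ennreal (D * s)"
  shows "ennreal l * emeasure lborel {x. \<exists>z\<in>cone x. cmod (g z) > l}
    \<le> 640 * (\<integral>\<^sup>+t. ennreal (cmod (g (Complex t 0))) * indicator {t. cmod (g (Complex t 0)) > l / 128} t \<partial>lborel)"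
proof -
  define G where "G t = cmod (g (Complex t 0))" for t
  have contg: "continuous_on {z. Im z > - e} g"
    using hol by (rule holomorphic_on_imp_continuous_on)
  have "continuous_on UNIV G"
    unfolding Complex_eq G_def using e
    by (intro continuous_intros continuous_on_compose2[OF contg]) auto
  then have G[measurable]: "G \<in> borel_measurable borel"
    by (rule borel_measurable_continuous_onI)
  have G0: "G t \<ge> 0" for t by (simp add: G_def)
  define h where "h t = ennreal (G t) * indicator {t. G t > l / 128} t" for t
  have h[measurable]: "h \<in> borel_measurable lborel" unfolding h_def by measurable
  have "ennreal (l / 64) * emeasure lborel {x. \<exists>z\<in>cone x. cmod (g z) > l} \<le> 10 * (\<integral>\<^sup>+t. h t \<partial>lborel)"
  proof (rule ball_average_weak_type[OF h])
    fix x assume "x \<in> {x. \<exists>z\<in>cone x. cmod (g z) > l}"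
    then obtain z where z: "z \<in> cone x" "cmod (g z) > l" by auto
    have y: "Im z > 0" "\<bar>Re z - x\<bar> < Im z" using z(1) by (auto simp: cone_def)
    show "\<exists>r>0. ennreal (l / 64 * r) < (\<integral>\<^sup>+t. h t * indicator (ball x r) t \<partial>lborel)"
    proof (rule ccontr)
      assume "\<not> ?thesis"
      then have h_avg: "(\<integral>\<^sup>+t. h t * indicator (ball x r) t \<partial>lborel) \<le> ennreal (l / 64 * r)" if "r > 0" for r
        using that by (meson not_le)
      have avg: "(\<integral>\<^sup>+t. ennreal (G t) * indicator (ball x r) t \<partial>lborel) \<le> ennreal (l / 32 * r)" if r: "r > 0" for r
      proof -
        have "(\<integral>\<^sup>+t. ennreal (G t) * indicator (ball x r) t \<partial>lborel)
          \<le> (\<integral>\<^sup>+t. h t * indicator (ball x r) t + ennreal (l / 128) * indicator (ball x r) t \<partial>lborel)"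
          using l by (intro nn_integral_mono) (auto simp: h_def indicator_def intro: ennreal_leI)
        also have "\<dots> = (\<integral>\<^sup>+t. h t * indicator (ball x r) t \<partial>lborel) + ennreal (l / 128) * ennreal (2 * r)"
          using r by (subst nn_integral_add) (auto simp: nn_integral_cmult_indicator ball_eq_greaterThanLessThan)
        also have "\<dots> \<le> ennreal (l / 64 * r) + ennreal (l / 128) * ennreal (2 * r)"
          by (intro add_right_mono h_avg r)
        also have "\<dots> = ennreal (l / 32 * r)"
          using l r by (simp add: ennreal_mult'[symmetric] ennreal_plus[symmetric] del: ennreal_plus)
        finally show ?thesis .
      qed
      have "ennreal (pi * cmod (g (Complex (Re z) (Im z))) / Im z)
          \<le> (\<integral>\<^sup>+t. ennreal (G t / ((t - Re z)\<^sup>2 + (Im z)\<^sup>2)) \<partial>lborel)"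
        unfolding G_def by (rule Poisson_majorant[OF hol e y(1) D bd])
      also have "\<dots> = (\<integral>\<^sup>+t. ennreal (G t) * ennreal (1 / ((t - Re z)\<^sup>2 + (Im z)\<^sup>2)) \<partial>lborel)"
        using G0 by (intro nn_integral_cong) (simp add: ennreal_mult'[symmetric])
      also have "\<dots> \<le> ennreal (32 * (l / 32) / Im z)"
        by (rule Poisson_le_ball_averages[OF _ y _ avg]) (use l in auto)
      finally have "pi * cmod (g z) / Im z \<le> l / Im z"
        using l y by (simp add: ennreal_le_iff)
      then have "pi * cmod (g z) \<le> l" using y by (simp add: field_simps)
      moreover have "cmod (g z) \<le> pi * cmod (g z)" using pi_ge_two by (simp add: mult_le_cancel_right1)
      ultimately show False using z(2) by linarith
    qed
  qed (use l in auto)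
  then have "ennreal 64 * (ennreal (l / 64) * emeasure lborel {x. \<exists>z\<in>cone x. cmod (g z) > l})
     \<le> ennreal 64 * (10 * (\<integral>\<^sup>+t. h t \<partial>lborel))"
    by (rule mult_left_mono) simp
  moreover have "ennreal 64 * (ennreal (l / 64) * m) = ennreal l * m" for m
  proof -
    have "ennreal 64 * ennreal (l / 64) = ennreal l"
      using l by (subst ennreal_mult'[symmetric]) simp_all
    then show ?thesis by (simp only: mult.assoc[symmetric])
  qed
  moreover have "ennreal 64 * (10 * m) = 640 * m" for m
  proof -
    have "ennreal 64 * 10 = 640" by simp
    then show ?thesis by (simp only: mult.assoc[symmetric])
  qed
  ultimately show ?thesis by (simp only: h_def G_def)
qed

section \<open>Dilation of the growth function\<close>

lemma nabla2_dilation: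
  assumes growth: "growth_function \<Phi>" and conv: "convex_on {0..} \<Phi>" and C1: "C1_on_nonneg \<Phi>"
    and nabla: "nabla2 \<Phi>"
  obtains a :: real where "a \<ge> 2" "\<And>t. t \<ge> 0 \<Longrightarrow> 2 * a * \<Phi> t \<le> \<Phi> (a * t)"
proof -
  obtain \<Phi>' where \<Phi>': "\<And>t. t \<ge> 0 \<Longrightarrow> (\<Phi> has_real_derivative \<Phi>' t) (at t within {0..})"
    using C1 by (auto simp: C1_on_nonneg_def)
  obtain K where K: "K > 1" "\<And>s. s \<ge> 0 \<Longrightarrow> complementary \<Phi> (2 * s) \<le> ereal K * complementary \<Phi> s"
    using nabla by (auto simp: nabla2_def doubling_def)
  have mono: "\<Phi> s \<le> \<Phi> t" if "0 \<le> s" "s \<le> t" for s t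
    using growth that by (auto simp: growth_function_def mono_on_def)
  have nonneg: "\<Phi> t \<ge> 0" if "t \<ge> 0" for t
    using growth that by (auto simp: growth_function_def)
  have zero: "\<Phi> 0 = 0"
  proof -
    have "0 \<in> \<Phi> ` {0..}" using growth by (auto simp: growth_function_def)
    then obtain t where "t \<ge> 0" "\<Phi> t = 0" by auto
    then show ?thesis using mono[of 0 t] nonneg[of 0] by simp
  qed
  \<comment> \<open>\<open>K \<le> 2 * a\<close> allows K to be replaced by 2 a below, because t s -
    \<Phi>(t) is nonnegative by the tangent inequality at 0; the terms 2 a t s then cancel. The
    bound \<open>a \<ge> 2\<close> makes a the base of a geometric scale of levels.\<close>
  define a where "a = max 2 K"
  have a: "a \<ge> 2" "a \<ge> K" by (auto simp: a_def)
  have "2 * a * \<Phi> t \<le> \<Phi> (a * t)" if t: "t > 0" for t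
  proof -
    text \<open>With the slope \<open>s\<close> at \<open>t\<close>, Young's inequality is an equality at \<open>(t, s)\<close>; it is compared
      with Young's inequality at \<open>(a * t, 2 * s)\<close>.\<close>
    define s where "s = \<Phi>' t"
    have tangent: "\<Phi> u - \<Phi> t \<ge> s * (u - t)" if "u \<ge> 0" for u
      unfolding s_def
      by (rule convex_on_imp_above_tangent[OF conv]) (use t that \<Phi>'[of t] in \<open>auto simp: interior_real_atLeast\<close>)
    have s: "s \<ge> 0"
    proof -
      have "s * t \<ge> 0" using tangent[of 0] zero nonneg[of t] t by simp
      then show ?thesis using t by (simp add: zero_le_mult_iff)
    qed
    have le: "complementary \<Phi> s \<le> ereal (t * s - \<Phi> t)"
      unfolding complementary_def
    proof (rule SUP_least)
      fix u :: real assume "u \<in> {0..}"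
      then show "ereal (u * s - \<Phi> u) \<le> ereal (t * s - \<Phi> t)"
        using tangent[of u] by (simp add: algebra_simps)
    qed
    have "ereal (a * t * (2 * s) - \<Phi> (a * t)) \<le> complementary \<Phi> (2 * s)"
      unfolding complementary_def using a t by (intro SUP_upper) auto
    also have "\<dots> \<le> ereal K * complementary \<Phi> s" by (rule K(2)[OF s])
    also have "\<dots> \<le> ereal K * ereal (t * s - \<Phi> t)"
      using K(1) by (intro ereal_mult_left_mono le) auto
    finally have "a * t * (2 * s) - \<Phi> (a * t) \<le> K * (t * s - \<Phi> t)" by simp
    also have "\<dots> \<le> 2 * a * (t * s - \<Phi> t)"
      using a tangent[of 0] zero by (intro mult_right_mono) (auto simp: algebra_simps)
    finally show ?thesis by (simp add: algebra_simps)
  qed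
  then have "2 * a * \<Phi> t \<le> \<Phi> (a * t)" if "t \<ge> 0" for t
    using that zero by (cases "t = 0") auto
  then show thesis using that a(1) by blast
qed

text \<open>These are the consequences of the hypotheses on \<Phi> that the strong type argument
  works with. All growth estimates are about the ratio \<Phi>(t) / t: convexity and
  \<open>zero\<close> make it nondecreasing, and \<open>dilation\<close> is its doubling under t ->
  a t.\<close>

locale dilating_convex =
  fixes \<Phi> :: "real \<Rightarrow> real" and a :: real
  assumes cont: "continuous_on {0..} \<Phi>" and conv: "convex_on {0..} \<Phi>"
    and zero: "\<Phi> 0 = 0" and pos: "t > 0 \<Longrightarrow> \<Phi> t > 0"
    and a: "a \<ge> 2" and dilation: "t \<ge> 0 \<Longrightarrow> 2 * a * \<Phi> t \<le> \<Phi> (a * t)"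
begin

lemma nonneg: "t \<ge> 0 \<Longrightarrow> \<Phi> t \<ge> 0"
  using pos[of t] zero by (cases "t = 0") auto

lemma scale_le:
  assumes "0 \<le> c" "c \<le> 1" "t \<ge> 0"
  shows "\<Phi> (c * t) \<le> c * \<Phi> t"
  using convex_onD[OF conv, of c 0 t] assms zero by simp

lemma mono:
  assumes "0 \<le> s" "s \<le> t"
  shows "\<Phi> s \<le> \<Phi> t"
proof (cases "t = 0")
  case False
  then have t: "t > 0" using assms by simp
  have "\<Phi> (s / t * t) \<le> s / t * \<Phi> t" using assms t by (intro scale_le) auto
  also have "\<dots> \<le> 1 * \<Phi> t" using assms t nonneg[of t] by (intro mult_right_mono) auto
  finally show ?thesis using t by simp
qed (use assms in auto)

lemma ratio_mono:
  assumes "0 < s" "s \<le> t"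
  shows "\<Phi> s / s \<le> \<Phi> t / t"
proof -
  have "\<Phi> (s / t * t) \<le> s / t * \<Phi> t" using assms by (intro scale_le) auto
  then show ?thesis using assms by (simp add: field_simps)
qed

text \<open>Beyond 1 the ratio \<Phi>(u) / u is at least \<Phi>(1). The inequality turns a bound for
  the integral of \<Phi>(|f|) into one for the integral of |f| over a bounded interval.\<close>

lemma le_add_Phi:
  assumes "u \<ge> 0"
  shows "u \<le> 1 + \<Phi> u / \<Phi> 1"
proof (cases "u \<le> 1")
  case True
  have "\<Phi> u / \<Phi> 1 \<ge> 0" using nonneg assms pos[of 1] by simp
  then show ?thesis using True by linarith
next
  case False
  then have "\<Phi> 1 / 1 \<le> \<Phi> u / u" by (intro ratio_mono) auto
  then have "u * \<Phi> 1 \<le> \<Phi> u" using False by (simp add: field_simps)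
  then have "u \<le> \<Phi> u / \<Phi> 1" using pos[of 1] by (simp add: field_simps)
  then show ?thesis by simp
qed

text \<open>The weight at least halves with each step down, so the whole sum is at most twice the
  weight of the highest level below u. That weight is at most \<Phi>(u) / u by monotonicity of the
  ratio.\<close>

lemma layer_sum_le:
  assumes u: "u \<ge> 0"
  shows "ennreal u * (\<integral>\<^sup>+k. ennreal (\<Phi> (a powr real_of_int k) / a powr real_of_int k) * indicator {k. a powr (real_of_int k) < u} k \<partial>count_space UNIV)
    \<le> ennreal (2 * \<Phi> u)"
proof (cases "u = 0")
  case False
  then have u: "u > 0" using u by simp
  define w where "w k = \<Phi> (a powr (real_of_int k)) / a powr (real_of_int k)" for k :: int
  have w0: "w k \<ge> 0" for k using nonneg by (simp add: w_def)
  \<comment> \<open>The largest integer strictly below log a u. The floor would be wrong when u is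
    itself a power of a.\<close>
  define K where "K = \<lceil>log a u\<rceil> - 1"
  have K: "a powr k < u \<longleftrightarrow> k \<le> K" for k :: int
  proof -
    have "a powr k < u \<longleftrightarrow> real_of_int k < log a u" using a u by (simp add: less_log_iff)
    also have "\<dots> \<longleftrightarrow> k < \<lceil>log a u\<rceil>" by (simp add: less_ceiling_iff)
    finally show ?thesis by (simp add: K_def)
  qed
  have half: "w (k - 1) \<le> w k / 2" for k
  proof -
    define b where "b = a powr (real_of_int k - 1)"
    have b: "b > 0" "a powr k = a * b" using a by (simp_all add: b_def powr_mult_base)
    have "2 * a * \<Phi> b \<le> \<Phi> (a * b)" using b by (intro dilation) simp
    then show ?thesis using a b by (simp add: w_def b_def[symmetric] field_simps)
  qed
  have geo: "w (K - int n) \<le> w K * (1/2) ^ n" for n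
  proof (induction n)
    case (Suc n)
    have "w (K - int (Suc n)) = w (K - int n - 1)" by (simp add: algebra_simps)
    also have "\<dots> \<le> w (K - int n) / 2" by (rule half)
    finally show ?case using Suc by simp
  qed simp
  have "(\<integral>\<^sup>+k. ennreal (w k) * indicator {k. a powr (real_of_int k) < u} k \<partial>count_space UNIV)
      = (\<integral>\<^sup>+k. ennreal (w k) \<partial>count_space {..K})"
    by (simp add: K nn_integral_count_space_indicator) (simp add: atMost_def)
  also have "\<dots> = (\<integral>\<^sup>+n. ennreal (w (K - int n)) \<partial>count_space UNIV)"
  proof (rule nn_integral_bij_count_space[symmetric])
    show "bij_betw (\<lambda>n. K - int n) UNIV {..K}"
      by (rule bij_betwI[where g = "\<lambda>k. nat (K - k)"]) auto
  qed
  also have "\<dots> \<le> (\<integral>\<^sup>+n. ennreal (w K * (1/2) ^ n) \<partial>count_space UNIV)"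
    by (intro nn_integral_mono ennreal_leI geo)
  also have "\<dots> = (\<Sum>n. ennreal (w K * (1/2) ^ n))" by (rule nn_integral_count_space_nat)
  also have "\<dots> = ennreal (2 * w K)"
  proof (rule suminf_ennreal_eq)
    show "0 \<le> w K * (1/2) ^ n" for n using w0 by simp
    have "(\<lambda>n. w K * (1/2) ^ n) sums (w K * (1 / (1 - 1/2)))"
      by (intro sums_mult geometric_sums) simp
    then show "(\<lambda>n. w K * (1/2) ^ n) sums (2 * w K)" by (simp add: mult.commute)
  qed
  also have "\<dots> \<le> ennreal (2 * (\<Phi> u / u))"
    unfolding w_def using K[of K] a by (intro ennreal_leI mult_left_mono ratio_mono) auto
  finally have "ennreal u * (\<integral>\<^sup>+k. ennreal (w k) * indicator {k. a powr (real_of_int k) < u} k \<partial>count_space UNIV)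
     \<le> ennreal u * ennreal (2 * (\<Phi> u / u))"
    by (rule mult_left_mono) simp
  also have "\<dots> = ennreal (2 * \<Phi> u)" using u by (subst ennreal_mult'[symmetric]) simp_all
  finally show ?thesis by (simp only: w_def)
qed simp

text \<open>For finite v > 0 a single summand is enough: if a^(k-1) < v \<le> a^k, then \<Phi>(a^k)
  already dominates \<Phi>(v). The gap between the exponents k - 1 and k is what costs the factor a
  in the final constant. For v = \<open>top\<close> every level occurs and the summands are
  unbounded.\<close>

lemma Phi_ext_le_layers:
  "Phi_ext \<Phi> v \<le> (\<integral>\<^sup>+k. ennreal (\<Phi> (a powr real_of_int k)) * indicator {k. ennreal (a powr (real_of_int k - 1)) < v} k \<partial>count_space UNIV)"
    (is "_ \<le> ?R")
proof -
  have term_le: "ennreal (\<Phi> (a powr k)) \<le> ?R" if "ennreal (a powr (real_of_int k - 1)) < v" for k :: int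
    using nn_integral_ge_point[of k UNIV "\<lambda>k. ennreal (\<Phi> (a powr real_of_int k)) * indicator {k. ennreal (a powr (real_of_int k - 1)) < v} k"] that
    by simp
  show ?thesis
  proof (cases v)
    case (real u)
    show ?thesis
    proof (cases "u = 0")
      case False
      then have u: "u > 0" using real by simp
      define k where "k = \<lceil>log a u\<rceil>"
      have k: "log a u \<le> k" "k - 1 < log a u" unfolding k_def by linarith+
      have "a powr (k - 1) < u" using k(2) a u by (simp add: less_log_iff)
      then have "ennreal (\<Phi> (a powr k)) \<le> ?R"
        using real u by (intro term_le) (simp add: ennreal_less_iff)
      moreover have "u \<le> a powr k" using k(1) a u by (simp add: log_le_iff)
      then have "\<Phi> u \<le> \<Phi> (a powr k)" using u by (intro mono) auto
      ultimately show ?thesis using real by (simp add: Phi_ext_def) (meson ennreal_leI order_trans)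
    qed (simp add: real Phi_ext_def zero)
  next
    case top
    have "?R = \<infinity>"
    proof (rule ccontr)
      assume "?R \<noteq> \<infinity>"
      then obtain b where b: "b \<ge> 0" "?R = ennreal b" by (cases ?R) auto
      \<comment> \<open>Chosen so that \<Phi>(a^k) \<ge> a^k \<Phi>(1) \<ge> k \<Phi>(1) > b, which
        makes one summand exceed the supposed value of the sum.\<close>
      define k where "k = \<lceil>b / \<Phi> 1\<rceil> + 1"
      have k: "real_of_int k > b / \<Phi> 1" "k \<ge> 1" 
      proof -
        have "b / \<Phi> 1 \<ge> 0" using b pos[of 1] by simp
        then have "\<lceil>b / \<Phi> 1\<rceil> \<ge> 0" by linarith
        then show "k \<ge> 1" by (simp add: k_def)
        show "real_of_int k > b / \<Phi> 1" unfolding k_def by linarith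
      qed
      have "real_of_int k \<le> a powr k"
      proof -
        have "real (nat k) < 2 ^ nat k" by (rule of_nat_less_two_power)
        also have "\<dots> \<le> a ^ nat k" using a by (intro power_mono) auto
        also have "\<dots> = a powr k" using a k by (simp add: powr_realpow[symmetric])
        finally show ?thesis using k by simp
      qed
      also have "\<dots> \<le> 1 * \<Phi> (a powr k) / \<Phi> 1"
      proof -
        have "1 \<le> a powr k" using a k by (intro ge_one_powr_ge_zero) auto
        then have "\<Phi> 1 / 1 \<le> \<Phi> (a powr k) / a powr k" by (intro ratio_mono) auto
        moreover have "a powr k > 0" using a by simp
        ultimately show ?thesis using pos[of 1] by (simp add: field_simps)
      qed
      finally have "b < \<Phi> (a powr k)" using k pos[of 1] by (simp add: field_simps)
      moreover have "ennreal (\<Phi> (a powr k)) \<le> ennreal b" using term_le[of k] top b by simp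
      ultimately show False using b by (simp add: ennreal_le_iff)
    qed
    then show ?thesis by simp
  qed
qed

lemma Phi_ext_mono: "u \<le> v \<Longrightarrow> Phi_ext \<Phi> u \<le> Phi_ext \<Phi> v"
proof (cases "v = top")
  case False
  assume "u \<le> v"
  then show ?thesis using False
    by (auto simp: Phi_ext_def top_unique less_top intro!: ennreal_leI mono enn2real_mono)
qed (simp add: Phi_ext_def)

text \<open>Used with c = 1/10 to bring a modular bounded by 10 down to 1, the threshold in
  \<open>lux_norm\<close>.\<close>

lemma Phi_ext_scale:
  assumes "0 < c" "c \<le> 1"
  shows "Phi_ext \<Phi> (ennreal c * v) \<le> ennreal c * Phi_ext \<Phi> v"
proof (cases v)
  case (real u)
  then show ?thesis
    using scale_le[of c u] assms by (simp add: Phi_ext_def ennreal_mult'[symmetric] ennreal_leI)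
next
  case top
  then show ?thesis using assms by (simp add: Phi_ext_def ennreal_mult_top)
qed

end

section \<open>The strong type inequality\<close>

context dilating_convex
begin

text \<open>Supplies the linear growth hypothesis of the Poisson majorant: the mass exceeds the
  length 2 s by at most 1 / \<Phi>(1), and s \<ge> 1 absorbs this constant into a multiple of
  s.\<close>

lemma line_integral_bound:
  assumes meas: "(\<lambda>t. cmod (F (Complex t v))) \<in> borel_measurable borel"
    and F: "(\<integral>\<^sup>+t. ennreal (\<Phi> (cmod (F (Complex t v)))) \<partial>lborel) \<le> 1" and s: "s \<ge> 1"
  shows "(\<integral>\<^sup>+t. ennreal (cmod (F (Complex t v))) * indicator {-s..s} t \<partial>lborel) \<le> ennreal ((2 + 1 / \<Phi> 1) * s)"
proof -
  define u where "u t = cmod (F (Complex t v))" for t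
  have u0: "u t \<ge> 0" for t by (simp add: u_def)
  have P1: "\<Phi> 1 > 0" using pos by simp
  \<comment> \<open>\<Phi> is continuous on \<open>{0..}\<close> only; \<open>max 0\<close> extends
    it continuously to the line without changing it at the values of |F|.\<close>
  have "(\<lambda>t. \<Phi> (max 0 t)) \<in> borel_measurable borel"
    by (intro borel_measurable_continuous_onI continuous_on_compose2[OF cont] continuous_intros) auto
  then have "(\<lambda>t. \<Phi> (max 0 (u t))) \<in> borel_measurable borel"
    using meas unfolding u_def by (rule measurable_compose_rev)
  then have [measurable]: "(\<lambda>t. \<Phi> (u t)) \<in> borel_measurable borel"
    using u0 by (simp add: max_absorb2)
  have "(\<integral>\<^sup>+t. ennreal (u t) * indicator {-s..s} t \<partial>lborel)
      \<le> (\<integral>\<^sup>+t. indicator {-s..s} t + ennreal (1 / \<Phi> 1) * ennreal (\<Phi> (u t)) \<partial>lborel)"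
  proof (rule nn_integral_mono)
    fix t
    have "ennreal (u t) \<le> ennreal (1 + 1 / \<Phi> 1 * \<Phi> (u t))"
      using le_add_Phi[OF u0[of t]] by (intro ennreal_leI) simp
    also have "\<dots> = 1 + ennreal (1 / \<Phi> 1) * ennreal (\<Phi> (u t))"
      using P1 nonneg[OF u0[of t]] by (simp add: ennreal_mult'[symmetric])
    finally show "ennreal (u t) * indicator {-s..s} t \<le> indicator {-s..s} t + ennreal (1 / \<Phi> 1) * ennreal (\<Phi> (u t))"
      by (auto simp: indicator_def)
  qed
  also have "\<dots> = (\<integral>\<^sup>+t. indicator {-s..s} t \<partial>lborel) + (\<integral>\<^sup>+t. ennreal (1 / \<Phi> 1) * ennreal (\<Phi> (u t)) \<partial>lborel)"
    by (rule nn_integral_add) simp_all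
  also have "(\<integral>\<^sup>+t. ennreal (1 / \<Phi> 1) * ennreal (\<Phi> (u t)) \<partial>lborel) = ennreal (1 / \<Phi> 1) * (\<integral>\<^sup>+t. ennreal (\<Phi> (u t)) \<partial>lborel)"
    by (rule nn_integral_cmult) simp
  also have "(\<integral>\<^sup>+t. indicator {-s..s} t \<partial>lborel) = ennreal (2 * s)" using s by simp
  also have "ennreal (2 * s) + ennreal (1 / \<Phi> 1) * (\<integral>\<^sup>+t. ennreal (\<Phi> (u t)) \<partial>lborel) \<le> ennreal (2 * s) + ennreal (1 / \<Phi> 1) * 1"
    using F by (intro add_left_mono mult_left_mono) (simp_all add: u_def)
  also have "\<dots> = ennreal (2 * s + 1 / \<Phi> 1)" using s P1 by simp
  also have "\<dots> \<le> ennreal ((2 + 1 / \<Phi> 1) * s)"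
  proof (rule ennreal_leI)
    have "1 / \<Phi> 1 * 1 \<le> 1 / \<Phi> 1 * s" using s P1 by (intro mult_left_mono) auto
    then show "2 * s + 1 / \<Phi> 1 \<le> (2 + 1 / \<Phi> 1) * s" by (simp add: algebra_simps)
  qed
  finally show ?thesis by (simp only: u_def)
qed

text \<open>The weak type inequality at level 128 a^k truncates exactly at a^k. Multiplied by
  \<Phi>(a^k) / (128 a^k) and summed over k, its right side becomes, after exchanging sum and
  integral, the sum of \<open>layer_sum_le\<close> with u = |g|. The bound 10 is 640 / 128 = 5 times
  the 2 from there, and it does not depend on e.\<close>

lemma nontangential_layer_bound:
  assumes hol: "F holomorphic_on upper_half_plane" and e: "e > 0"
    and F: "\<And>y. y > 0 \<Longrightarrow> (\<integral>\<^sup>+x. ennreal (\<Phi> (cmod (F (Complex x y)))) \<partial>lborel) \<le> 1"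
  shows "(\<integral>\<^sup>+k. ennreal (\<Phi> (a powr real_of_int k)) *
      emeasure lborel {x. \<exists>z\<in>cone x. cmod (F (z + \<i> * of_real e)) > 128 * a powr real_of_int k} \<partial>count_space UNIV) \<le> 10"
proof -
  define g where "g z = F (z + \<i> * of_real e)" for z
  have gC: "g (Complex t v) = F (Complex t (v + e))" for t v
    by (simp add: g_def Complex_eq algebra_simps)
  have hol_g: "g holomorphic_on {z. Im z > - e}"
    unfolding g_def
    by (rule holomorphic_on_compose_gen[OF _ hol, unfolded o_def]) (auto intro!: holomorphic_intros simp: upper_half_plane_def)
  have contF: "continuous_on upper_half_plane F"
    using hol by (rule holomorphic_on_imp_continuous_on)
  have line[measurable]: "(\<lambda>t. cmod (F (Complex t y))) \<in> borel_measurable borel" if "y > 0" for y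
    unfolding Complex_eq using that
    by (intro borel_measurable_continuous_onI continuous_intros continuous_on_compose2[OF contF])
      (auto simp: upper_half_plane_def)
  define D where "D = 2 + 1 / \<Phi> 1"
  have D: "D \<ge> 0" using pos[of 1] by (simp add: D_def)
  have bd: "(\<integral>\<^sup>+t. ennreal (cmod (g (Complex t v))) * indicator {-s..s} t \<partial>lborel) \<le> ennreal (D * s)"
    if "v \<ge> 0" "s \<ge> 1" for v s
    unfolding gC D_def using that e by (intro line_integral_bound line F) auto
  define u where "u t = cmod (g (Complex t 0))" for t
  have u0: "u t \<ge> 0" for t by (simp add: u_def)
  have u[measurable]: "u \<in> borel_measurable borel"
    using line[of e] e by (simp add: u_def[abs_def] gC)
  define w where "w k = \<Phi> (a powr real_of_int k) / a powr real_of_int k" for k :: int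
  have w0: "w k \<ge> 0" for k using nonneg by (simp add: w_def)
  have ap: "a powr real_of_int k > 0" for k using a by simp
  define T where "T k t = ennreal (w k) * (ennreal (u t) * indicator {t. u t > a powr real_of_int k} t)" for k t
  have T[measurable]: "T k \<in> borel_measurable lborel" for k unfolding T_def by measurable
  have "(\<integral>\<^sup>+k. ennreal (\<Phi> (a powr real_of_int k)) *
      emeasure lborel {x. \<exists>z\<in>cone x. cmod (g z) > 128 * a powr real_of_int k} \<partial>count_space UNIV)
     \<le> (\<integral>\<^sup>+k. 5 * (\<integral>\<^sup>+t. T k t \<partial>lborel) \<partial>count_space UNIV)"
  proof (rule nn_integral_mono)
    fix k :: int
    define A where "A = {x. \<exists>z\<in>cone x. cmod (g z) > 128 * a powr real_of_int k}"
    define I where "I = (\<integral>\<^sup>+t. ennreal (u t) * indicator {t. u t > a powr real_of_int k} t \<partial>lborel)"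
    have "ennreal (128 * a powr real_of_int k) * emeasure lborel A \<le> 640 * I"
      using nontangential_weak_type[OF hol_g e D _ bd, of "128 * a powr real_of_int k"] ap[of k]
      by (simp add: A_def I_def u_def)
    then have "ennreal (w k / 128) * (ennreal (128 * a powr real_of_int k) * emeasure lborel A) \<le> ennreal (w k / 128) * (640 * I)"
      by (rule mult_left_mono) simp
    moreover have "ennreal (w k / 128) * (ennreal (128 * a powr real_of_int k) * emeasure lborel A) = ennreal (\<Phi> (a powr real_of_int k)) * emeasure lborel A"
    proof -
      have "ennreal (w k / 128) * ennreal (128 * a powr real_of_int k) = ennreal (\<Phi> (a powr real_of_int k))"
        using w0[of k] ap[of k] by (subst ennreal_mult'[symmetric]) (simp_all add: w_def)
      then show ?thesis by (simp only: mult.assoc[symmetric])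
    qed
    moreover have "ennreal (w k / 128) * (640 * I) = 5 * (ennreal (w k) * I)"
    proof -
      have "ennreal (w k / 128) * 640 = ennreal (w k / 128) * ennreal 640" by simp
      also have "\<dots> = ennreal (5 * w k)" using w0[of k] by (subst ennreal_mult'[symmetric]) simp_all
      also have "\<dots> = 5 * ennreal (w k)" by (subst ennreal_mult') simp_all
      finally show ?thesis by (simp only: mult.assoc[symmetric])
    qed
    moreover have "ennreal (w k) * I = (\<integral>\<^sup>+t. T k t \<partial>lborel)"
      unfolding T_def I_def by (rule nn_integral_cmult[symmetric]) measurable
    ultimately show "ennreal (\<Phi> (a powr real_of_int k)) *
      emeasure lborel {x. \<exists>z\<in>cone x. cmod (g z) > 128 * a powr real_of_int k} \<le> 5 * (\<integral>\<^sup>+t. T k t \<partial>lborel)"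
      by (simp only: A_def)
  qed
  also have "\<dots> = 5 * (\<integral>\<^sup>+k. \<integral>\<^sup>+t. T k t \<partial>lborel \<partial>count_space UNIV)"
    by (rule nn_integral_cmult) simp
  also have "(\<integral>\<^sup>+k. \<integral>\<^sup>+t. T k t \<partial>lborel \<partial>count_space UNIV) = (\<integral>\<^sup>+t. \<integral>\<^sup>+k. T k t \<partial>count_space UNIV \<partial>lborel)"
    by (rule nn_integral_count_space_nn_integral[symmetric]) simp_all
  also have "\<dots> \<le> (\<integral>\<^sup>+t. 2 * ennreal (\<Phi> (u t)) \<partial>lborel)"
  proof (rule nn_integral_mono)
    fix t :: real
    have "(\<integral>\<^sup>+k. T k t \<partial>count_space UNIV)
       = (\<integral>\<^sup>+k. ennreal (u t) * (ennreal (w k) * indicator {k. a powr real_of_int k < u t} k) \<partial>count_space UNIV)"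
      by (intro nn_integral_cong) (simp add: T_def indicator_def mult.commute)
    also have "\<dots> = ennreal (u t) * (\<integral>\<^sup>+k. ennreal (w k) * indicator {k. a powr real_of_int k < u t} k \<partial>count_space UNIV)"
      by (rule nn_integral_cmult) simp
    also have "\<dots> \<le> ennreal (2 * \<Phi> (u t))"
      unfolding w_def by (rule layer_sum_le[OF u0])
    also have "\<dots> = 2 * ennreal (\<Phi> (u t))" by (subst ennreal_mult') simp_all
    finally show "(\<integral>\<^sup>+k. T k t \<partial>count_space UNIV) \<le> 2 * ennreal (\<Phi> (u t))" .
  qed
  also have "\<dots> = 2 * (\<integral>\<^sup>+t. ennreal (\<Phi> (u t)) \<partial>lborel)"
  proof (rule nn_integral_cmult)
    have "(\<lambda>t. \<Phi> (max 0 t)) \<in> borel_measurable borel"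
      by (intro borel_measurable_continuous_onI continuous_on_compose2[OF cont] continuous_intros) auto
    then have "(\<lambda>t. \<Phi> (max 0 (u t))) \<in> borel_measurable borel"
      using u by (rule measurable_compose_rev)
    then show "(\<lambda>t. ennreal (\<Phi> (u t))) \<in> borel_measurable lborel"
      using u0 by (simp add: max_absorb2)
  qed
  also have "\<dots> \<le> 2 * 1"
    using F[OF e] by (intro mult_left_mono) (simp_all add: u_def gC)
  finally show ?thesis by (simp add: g_def mult_left_mono)
qed

text \<open>The sets \<open>E n k\<close> belong to the shift 1 / (n + 1). They increase to
  \<open>L k\<close>, because the cone is open, so that its points can be lowered a little, and is
  invariant under upward translation. Monotone convergence then carries the uniform layer bound over
  to the unshifted maximal function.\<close>

lemma nontangential_strong_type:
  assumes hol: "F holomorphic_on upper_half_plane"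
    and F: "\<And>y. y > 0 \<Longrightarrow> (\<integral>\<^sup>+x. ennreal (\<Phi> (cmod (F (Complex x y)))) \<partial>lborel) \<le> 1"
  shows "(\<integral>\<^sup>+x. Phi_ext \<Phi> (nontangential_max F x / ennreal (1280 * a)) \<partial>lborel) \<le> 1"
proof -
  define E where "E n k = {x. \<exists>z\<in>cone x. cmod (F (z + \<i> * of_real (1 / Suc n))) > 128 * a powr real_of_int k}" for n k
  define L where "L k = {x. ennreal (128 * a powr real_of_int k) < nontangential_max F x}" for k
  have ap: "a powr real_of_int k > 0" for k using a by simp
  have E_UN: "L k = (\<Union>n. E n k)" for k
  proof (intro set_eqI iffI)
    fix x assume "x \<in> L k"
    then obtain z where z: "z \<in> cone x" "128 * a powr real_of_int k < cmod (F z)"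
      using ap[of k] by (auto simp: L_def nontangential_max_def less_SUP_iff ennreal_less_iff)
    have "Im z - \<bar>Re z - x\<bar> > 0" using z(1) by (simp add: cone_def)
    then obtain n where n: "inverse (real (Suc n)) < Im z - \<bar>Re z - x\<bar>" using reals_Archimedean by blast
    have "z - \<i> * of_real (1 / Suc n) \<in> cone x" using n by (simp add: cone_def inverse_eq_divide)
    then have "x \<in> E n k" unfolding E_def using z(2) by (intro CollectI bexI[of _ "z - \<i> * of_real (1 / Suc n)"]) simp_all
    then show "x \<in> (\<Union>n. E n k)" by blast
  next
    fix x assume "x \<in> (\<Union>n. E n k)"
    then obtain n z where z: "z \<in> cone x" "cmod (F (z + \<i> * of_real (1 / Suc n))) > 128 * a powr real_of_int k"
      by (auto simp: E_def)
    have "z + \<i> * of_real (1 / Suc n) \<in> cone x"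
    proof -
      have up: "z + \<i> * of_real d \<in> cone x" if "d \<ge> 0" for d
        using z(1) that by (simp add: cone_def)
      show ?thesis by (rule up) simp
    qed
    moreover have "ennreal (128 * a powr real_of_int k) < ennreal (cmod (F (z + \<i> * of_real (1 / Suc n))))"
      using z(2) ap[of k] by (intro ennreal_lessI) auto
    ultimately show "x \<in> L k"
      unfolding L_def nontangential_max_def less_SUP_iff by blast
  qed
  have E_inc: "incseq (\<lambda>n. E n k)" for k
  proof (rule incseq_SucI, rule subsetI)
    fix n x assume "x \<in> E n k"
    then obtain z where z: "z \<in> cone x" "cmod (F (z + \<i> * of_real (1 / Suc n))) > 128 * a powr real_of_int k"
      by (auto simp: E_def)
    \<comment> \<open>Raising z by the difference of two consecutive shifts makes both shifted
      points coincide, so the same value of F is the witness at the next stage.\<close>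
    define z' where "z' = z + \<i> * of_real (1 / Suc n - 1 / Suc (Suc n))"
    have "1 / real (Suc (Suc n)) \<le> 1 / real (Suc n)" by (intro divide_left_mono) auto
    then have "z' \<in> cone x" using z(1) by (simp add: cone_def z'_def del: of_nat_Suc)
    moreover have "z' + \<i> * of_real (1 / Suc (Suc n)) = z + \<i> * of_real (1 / Suc n)"
      unfolding z'_def of_real_diff right_diff_distrib by simp
    ultimately show "x \<in> E (Suc n) k" unfolding E_def using z(2) by (intro CollectI bexI[of _ z']) simp_all
  qed
  have E_sets: "E n k \<in> sets lborel" for n k
    unfolding E_def using open_nontangential_level by simp
  have Einf_sets[measurable]: "L k \<in> sets borel" for k
    unfolding E_UN using E_sets by (simp add: sets.countable_UN)
  have layers: "(\<integral>\<^sup>+k. ennreal (\<Phi> (a powr real_of_int k)) * emeasure lborel (L k) \<partial>count_space UNIV) \<le> 10"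
  proof -
    have "ennreal (\<Phi> (a powr real_of_int k)) * emeasure lborel (L k)
       = (SUP n. ennreal (\<Phi> (a powr real_of_int k)) * emeasure lborel (E n k))" for k
      unfolding E_UN using SUP_emeasure_incseq[of "\<lambda>n. E n k" lborel] E_sets E_inc
      by (simp add: SUP_mult_left_ennreal[symmetric] image_subset_iff)
    then have "(\<integral>\<^sup>+k. ennreal (\<Phi> (a powr real_of_int k)) * emeasure lborel (L k) \<partial>count_space UNIV)
       = (\<integral>\<^sup>+k. (SUP n. ennreal (\<Phi> (a powr real_of_int k)) * emeasure lborel (E n k)) \<partial>count_space UNIV)"
      by simp
    also have "\<dots> = (SUP n. \<integral>\<^sup>+k. ennreal (\<Phi> (a powr real_of_int k)) * emeasure lborel (E n k) \<partial>count_space UNIV)"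
    proof (rule nn_integral_monotone_convergence_SUP)
      show "incseq (\<lambda>n k. ennreal (\<Phi> (a powr real_of_int k)) * emeasure lborel (E n k))"
        using E_inc E_sets by (auto simp: incseq_def le_fun_def intro!: mult_left_mono emeasure_mono)
    qed simp
    also have "\<dots> \<le> 10"
      unfolding E_def by (intro SUP_least nontangential_layer_bound hol F) auto
    finally show ?thesis .
  qed
  have "(\<integral>\<^sup>+x. Phi_ext \<Phi> (nontangential_max F x / ennreal (1280 * a)) \<partial>lborel)
     \<le> (\<integral>\<^sup>+x. \<integral>\<^sup>+k. ennreal (1/10) * (ennreal (\<Phi> (a powr real_of_int k)) * indicator (L k) x) \<partial>count_space UNIV \<partial>lborel)"
  proof (rule nn_integral_mono)
    fix x :: real
    \<comment> \<open>Division by 128 a turns the layer condition a^(k-1) < v into membership in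
      \<open>L k\<close>. The remaining factor 1/10 leaves \<open>Phi_ext\<close> by convexity and
      cancels the layer bound 10.\<close>
    define v where "v = nontangential_max F x / ennreal (128 * a)"
    have "nontangential_max F x / ennreal (1280 * a) = ennreal (1/10) * v"
    proof -
      have "inverse (ennreal (1280 * a)) = ennreal (1/10) * inverse (ennreal (128 * a))"
        using a by (simp add: inverse_ennreal ennreal_mult'[symmetric] field_simps)
      then show ?thesis by (simp add: v_def divide_ennreal_def mult_ac)
    qed
    then have "Phi_ext \<Phi> (nontangential_max F x / ennreal (1280 * a)) \<le> ennreal (1/10) * Phi_ext \<Phi> v"
      using Phi_ext_scale[of "1/10" v] by simp
    also have "\<dots> \<le> ennreal (1/10) * (\<integral>\<^sup>+k. ennreal (\<Phi> (a powr real_of_int k)) * indicator {k. ennreal (a powr (real_of_int k - 1)) < v} k \<partial>count_space UNIV)"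
      by (intro mult_left_mono Phi_ext_le_layers) simp
    also have "\<dots> \<le> ennreal (1/10) * (\<integral>\<^sup>+k. ennreal (\<Phi> (a powr real_of_int k)) * indicator (L k) x \<partial>count_space UNIV)"
    proof (rule mult_left_mono, rule nn_integral_mono)
      fix k :: int
      have "x \<in> L k" if "ennreal (a powr (real_of_int k - 1)) < v"
      proof (rule ccontr)
        assume "x \<notin> L k"
        then have "nontangential_max F x \<le> ennreal (128 * a powr real_of_int k)" by (simp add: L_def not_less)
        then have "v \<le> ennreal (128 * a powr real_of_int k) / ennreal (128 * a)"
          unfolding v_def by (rule divide_right_mono_ennreal)
        also have "\<dots> = ennreal (a powr (real_of_int k - 1))"
          using a by (simp add: divide_ennreal powr_diff)
        finally show False using that by simp
      qed
      then show "ennreal (\<Phi> (a powr real_of_int k)) * indicator {k. ennreal (a powr (real_of_int k - 1)) < v} k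
         \<le> ennreal (\<Phi> (a powr real_of_int k)) * indicator (L k) x"
        by (auto simp: indicator_def)
    qed simp
    also have "\<dots> = (\<integral>\<^sup>+k. ennreal (1/10) * (ennreal (\<Phi> (a powr real_of_int k)) * indicator (L k) x) \<partial>count_space UNIV)"
      by (rule nn_integral_cmult[symmetric]) simp
    finally show "Phi_ext \<Phi> (nontangential_max F x / ennreal (1280 * a))
       \<le> (\<integral>\<^sup>+k. ennreal (1/10) * (ennreal (\<Phi> (a powr real_of_int k)) * indicator (L k) x) \<partial>count_space UNIV)" .
  qed
  also have "\<dots> = (\<integral>\<^sup>+k. \<integral>\<^sup>+x. ennreal (1/10) * (ennreal (\<Phi> (a powr real_of_int k)) * indicator (L k) x) \<partial>lborel \<partial>count_space UNIV)"
    by (rule nn_integral_count_space_nn_integral) (simp, measurable)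
  also have "\<dots> = (\<integral>\<^sup>+k. ennreal (1/10) * (ennreal (\<Phi> (a powr real_of_int k)) * emeasure lborel (L k)) \<partial>count_space UNIV)"
    by (intro nn_integral_cong) (simp add: nn_integral_cmult)
  also have "\<dots> = ennreal (1/10) * (\<integral>\<^sup>+k. ennreal (\<Phi> (a powr real_of_int k)) * emeasure lborel (L k) \<partial>count_space UNIV)"
    by (rule nn_integral_cmult) simp
  also have "\<dots> \<le> ennreal (1/10) * 10"
    by (intro mult_left_mono layers) simp
  also have "\<dots> = ennreal (1/10) * ennreal 10" by simp
  also have "\<dots> = 1" by (subst ennreal_mult'[symmetric]) simp_all
  finally show ?thesis .
qed

section \<open>From modular inequalities to Luxemburg norms\<close>

lemma lux_norm_mono:
  assumes "\<And>x. g x \<le> h x"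
  shows "lux_norm \<Phi> g \<le> lux_norm \<Phi> h"
  unfolding lux_norm_def
proof (rule Inf_superset_mono, safe)
  fix r :: real
  assume r: "r > 0" "(\<integral>\<^sup>+x. Phi_ext \<Phi> (h x / ennreal r) \<partial>lborel) \<le> 1"
  have "(\<integral>\<^sup>+x. Phi_ext \<Phi> (g x / ennreal r) \<partial>lborel) \<le> (\<integral>\<^sup>+x. Phi_ext \<Phi> (h x / ennreal r) \<partial>lborel)"
    by (intro nn_integral_mono Phi_ext_mono divide_right_mono_ennreal assms)
  with r show "\<exists>r'. ereal r = ereal r' \<and> r' > 0 \<and> (\<integral>\<^sup>+x. Phi_ext \<Phi> (g x / ennreal r') \<partial>lborel) \<le> 1"
    by (intro exI[of _ r]) auto
qed

lemma lux_norm_nonneg: "lux_norm \<Phi> g \<ge> 0"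
  unfolding lux_norm_def by (rule Inf_greatest) auto

text \<open>Some admissible s lies below r, and admissibility passes from s to r by monotonicity of
  \<Phi>. The strict inequality avoids the question whether the infimum is attained.\<close>

lemma nn_integral_Phi_ext_le_1:
  assumes "lux_norm \<Phi> g < ereal r"
  shows "(\<integral>\<^sup>+x. Phi_ext \<Phi> (g x / ennreal r) \<partial>lborel) \<le> 1"
proof -
  obtain s where s: "s < r" "s > 0" "(\<integral>\<^sup>+x. Phi_ext \<Phi> (g x / ennreal s) \<partial>lborel) \<le> 1"
    using assms by (auto simp: lux_norm_def Inf_less_iff)
  have "g x / ennreal r \<le> g x / ennreal s" for x
    using s unfolding divide_ennreal_def
    by (intro mult_left_mono) (auto simp: inverse_ennreal intro!: ennreal_leI le_imp_inverse_le)
  then have "(\<integral>\<^sup>+x. Phi_ext \<Phi> (g x / ennreal r) \<partial>lborel) \<le> (\<integral>\<^sup>+x. Phi_ext \<Phi> (g x / ennreal s) \<partial>lborel)"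
    by (intro nn_integral_mono Phi_ext_mono)
  with s(3) show ?thesis by simp
qed

lemma hardy_orlicz_norm_le: "hardy_orlicz_norm \<Phi> f \<le> lux_norm \<Phi> (nontangential_max f)"
  unfolding hardy_orlicz_norm_def
proof (intro SUP_least lux_norm_mono)
  fix y x :: real assume "y \<in> {0<..}"
  then show "ennreal (cmod (f (Complex x y))) \<le> nontangential_max f x"
    unfolding nontangential_max_def by (intro SUP_upper) (simp add: cone_def)
qed

text \<open>By homogeneity, f / r has modular at most 1 on every line as soon as r exceeds the Hardy
  norm N, and the strong type inequality for f / r says that 1280 a r is admissible for the maximal
  function of f. Letting r decrease to N, instead of dividing by N, also covers N = 0.\<close>

lemma lux_norm_nontangential_max_le:
  assumes hol: "f holomorphic_on upper_half_plane"
  shows "lux_norm \<Phi> (nontangential_max f) \<le> ereal (1280 * a) * hardy_orlicz_norm \<Phi> f"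
proof -
  define N where "N = hardy_orlicz_norm \<Phi> f"
  have lux_le: "lux_norm \<Phi> (\<lambda>x. ennreal (cmod (f (Complex x y)))) \<le> N" if "y > 0" for y
    unfolding N_def hardy_orlicz_norm_def using that by (intro SUP_upper) simp
  have N0: "N \<ge> 0" using lux_norm_nonneg lux_le[of 1] order_trans by (metis zero_less_one)
  have step: "lux_norm \<Phi> (nontangential_max f) \<le> ereal (1280 * a * r)" if r: "N < ereal r" for r
  proof -
    have r0: "r > 0" using N0 r by (metis ereal_less(2) order.strict_trans1)
    define F where "F z = f z / of_real r" for z
    have "F holomorphic_on upper_half_plane"
      unfolding F_def using r0 by (intro holomorphic_intros hol) auto
    moreover have "(\<integral>\<^sup>+x. ennreal (\<Phi> (cmod (F (Complex x y)))) \<partial>lborel) \<le> 1" if y: "y > 0" for y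
    proof -
      have "lux_norm \<Phi> (\<lambda>x. ennreal (cmod (f (Complex x y)))) < ereal r"
        using lux_le[OF y] r by (rule order.strict_trans1)
      then have "(\<integral>\<^sup>+x. Phi_ext \<Phi> (ennreal (cmod (f (Complex x y))) / ennreal r) \<partial>lborel) \<le> 1"
        by (rule nn_integral_Phi_ext_le_1)
      moreover have "Phi_ext \<Phi> (ennreal (cmod (f (Complex x y))) / ennreal r) = ennreal (\<Phi> (cmod (F (Complex x y))))" for x
        using r0 by (simp add: divide_ennreal Phi_ext_def F_def norm_divide)
      ultimately show ?thesis by simp
    qed
    ultimately have "(\<integral>\<^sup>+x. Phi_ext \<Phi> (nontangential_max F x / ennreal (1280 * a)) \<partial>lborel) \<le> 1"
      by (rule nontangential_strong_type)
    moreover have "nontangential_max F x / ennreal (1280 * a) = nontangential_max f x / ennreal (1280 * a * r)" for x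
    proof -
      have "nontangential_max F x = nontangential_max f x / ennreal r"
        unfolding nontangential_max_def SUP_divide_ennreal F_def
        using r0 by (simp add: norm_divide divide_ennreal)
      moreover have "inverse (ennreal (1280 * a * r)) = inverse (ennreal r) * inverse (ennreal (1280 * a))"
        using a r0 by (simp add: inverse_ennreal ennreal_mult'[symmetric] field_simps)
      ultimately show ?thesis by (simp add: divide_ennreal_def mult_ac)
    qed
    ultimately show ?thesis
      unfolding lux_norm_def using a r0 by (intro Inf_lower) auto
  qed
  show ?thesis
  proof (cases N)
    case (real n)
    have "lux_norm \<Phi> (nontangential_max f) \<le> ereal (1280 * a) * N + ereal e" if e: "e > 0" for e
    proof -
      have "lux_norm \<Phi> (nontangential_max f) \<le> ereal (1280 * a * (n + e / (1280 * a)))"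
        using a e by (intro step) (simp add: real)
      also have "1280 * a * (n + e / (1280 * a)) = 1280 * a * n + e"
        using a by (simp add: field_simps)
      finally show ?thesis by (simp add: real)
    qed
    then show ?thesis unfolding N_def[symmetric] by (rule ereal_le_epsilon2)
  next
    case PInf
    then show ?thesis using a by (simp add: N_def[symmetric])
  next
    case MInf
    then show ?thesis using N0 by simp
  qed
qed

end

theorem theorem3p7:
  fixes \<Phi> :: "real \<Rightarrow> real"
  assumes "growth_function \<Phi>" and "convex_on {0..} \<Phi>" and "C1_on_nonneg \<Phi>" and "nabla2 \<Phi>"
  shows "\<exists>C>0. \<forall>f. f holomorphic_on upper_half_plane \<longrightarrow>
     ((hardy_orlicz_norm \<Phi> f < \<infinity> \<longleftrightarrow> lux_norm \<Phi> (nontangential_max f) < \<infinity>) \<and>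
      hardy_orlicz_norm \<Phi> f \<le> ereal C * lux_norm \<Phi> (nontangential_max f) \<and>
      lux_norm \<Phi> (nontangential_max f) \<le> ereal C * hardy_orlicz_norm \<Phi> f)"
proof -
  obtain a where a: "a \<ge> 2" "\<And>t. t \<ge> 0 \<Longrightarrow> 2 * a * \<Phi> t \<le> \<Phi> (a * t)"
    using nabla2_dilation[OF assms] by blast
  have mono: "\<Phi> s \<le> \<Phi> t" if "0 \<le> s" "s \<le> t" for s t
    using assms(1) that by (auto simp: growth_function_def mono_on_def)
  have nonneg: "\<Phi> t \<ge> 0" if "t \<ge> 0" for t
    using assms(1) that by (auto simp: growth_function_def)
  have surj: "\<exists>t\<ge>0. \<Phi> t = s" if "s \<ge> 0" for s
  proof -
    have "s \<in> \<Phi> ` {0..}" using assms(1) that by (simp add: growth_function_def)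
    then show ?thesis by auto
  qed
  have zero: "\<Phi> 0 = 0" using surj[of 0] mono nonneg[of 0] by force
  obtain K where K: "\<And>t. t \<ge> 0 \<Longrightarrow> \<Phi> (2 * t) \<le> K * \<Phi> t"
    using assms(4) by (auto simp: nabla2_def doubling_def)
  \<comment> \<open>This is where the doubling of \<Phi> itself enters. A zero at t > 0 would spread
    to every 2^n t, hence by monotonicity to all of \<open>{0..}\<close>, against
    surjectivity.\<close>
  have pos: "\<Phi> t > 0" if t: "t > 0" for t
  proof (rule ccontr)
    assume "\<not> \<Phi> t > 0"
    then have t0: "\<Phi> t = 0" using nonneg[of t] t by simp
    have pow0: "\<Phi> (2 ^ n * t) = 0" for n
    proof (induction n)
      case (Suc n)
      have "\<Phi> (2 * (2 ^ n * t)) \<le> K * \<Phi> (2 ^ n * t)" using t by (intro K) simp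
      then have "\<Phi> (2 ^ Suc n * t) \<le> 0" using Suc by (simp add: mult.assoc)
      moreover have "\<Phi> (2 ^ Suc n * t) \<ge> 0" using t by (intro nonneg) simp
      ultimately show ?case by simp
    qed (simp add: t0)
    obtain s where s: "s \<ge> 0" "\<Phi> s = 1" using surj[of 1] by auto
    obtain n where "s / t < 2 ^ n" using real_arch_pow[of 2 "s / t"] by auto
    then have "s \<le> 2 ^ n * t" using t by (simp add: field_simps)
    then show False using mono[OF s(1)] s(2) pow0[of n] by fastforce
  qed
  interpret dilating_convex \<Phi> a
    by unfold_locales (use assms(1,2) a zero pos in \<open>auto simp: growth_function_def\<close>)
  define C where "C = 1280 * a"
  have C: "C > 0" "C \<ge> 1" using a by (auto simp: C_def)
  show ?thesis
  proof (intro exI[of _ C] conjI allI impI)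
    fix f assume hol: "f holomorphic_on upper_half_plane"
    define M where "M = lux_norm \<Phi> (nontangential_max f)"
    have M0: "M \<ge> 0" unfolding M_def by (rule lux_norm_nonneg)
    have 1: "hardy_orlicz_norm \<Phi> f \<le> M" unfolding M_def by (rule hardy_orlicz_norm_le)
    have 2: "M \<le> ereal C * hardy_orlicz_norm \<Phi> f"
      unfolding M_def C_def by (rule lux_norm_nontangential_max_le[OF hol])
    \<comment> \<open>The easy direction holds with constant 1; since C \<ge> 1 and M \<ge> 0, the
      constant of the hard direction serves for both.\<close>
    have "ereal 1 * M \<le> ereal C * M" using C M0 by (intro ereal_mult_right_mono) auto
    then show "hardy_orlicz_norm \<Phi> f \<le> ereal C * lux_norm \<Phi> (nontangential_max f)"
      using 1 by (simp add: M_def[symmetric] one_ereal_def[symmetric])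
    show "lux_norm \<Phi> (nontangential_max f) \<le> ereal C * hardy_orlicz_norm \<Phi> f"
      using 2 by (simp add: M_def)
    show "hardy_orlicz_norm \<Phi> f < \<infinity> \<longleftrightarrow> lux_norm \<Phi> (nontangential_max f) < \<infinity>"
      unfolding M_def[symmetric]
    proof
      assume "hardy_orlicz_norm \<Phi> f < \<infinity>"
      then have "ereal C * hardy_orlicz_norm \<Phi> f < \<infinity>"
        using C by (cases "hardy_orlicz_norm \<Phi> f") auto
      then show "M < \<infinity>" using 2 by (rule order.strict_trans1[rotated])
    next
      assume "M < \<infinity>"
      then show "hardy_orlicz_norm \<Phi> f < \<infinity>" using 1 by (rule order.strict_trans1[rotated])
    qed
  qed (use C in simp)
qed

end
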